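(* Let $n$ be a positive integer. Let $\mathrm{u},\mathrm{h}_\perp$ be $i\mathbb{R}$-valued, $\mathrm{h}_\parallel$ be $\mathbb{R}$-valued, $\mathbf{u},\mathbf{h}_\perp$ be $\mathbb{C}^{n-1}$-valued (row vectors) and $\mathbf{H}_\parallel$ be complex-symmetric-$(n-1)\times(n-1)$-matrix-valued smooth functions of $(t,x)$. The SG flow on $(\mathrm{u},\mathbf{u})$ is given by $\mathrm{u}_t=\frac{2}{\sqrt{\chi}}\mathrm{h}_\perp$, $\mathbf{u}_t=-\frac{1}{\sqrt{\chi}}\overline{\mathbf{h}}_\perp$, with $\chi=8(n+1)$, together with $$\mathrm{h}_{\perp x}+2\mathrm{u}\mathrm{h}_\parallel+\mathbf{h}_\perp\mathbf{u}^t-\overline{\mathbf{h}}_\perp\overline{\mathbf{u}}^t=0,\tag{a}$$ $$\mathbf{h}_{\perp x}+\mathbf{u}\mathbf{H}_\parallel-\mathrm{h}_\parallel\overline{\mathbf{u}}+\mathrm{u}\mathbf{h}_\perp-\mathrm{h}_\perp\overline{\mathbf{u}}=0,\tag{b}$$ $$\mathrm{h}_{\parallel x}+2\mathrm{h}_\perp\mathrm{u}+\mathbf{h}_\perp\mathbf{u}^t+\overline{\mathbf{h}}_\perp\overline{\mathbf{u}}^t=0,\tag{c}$$ $$\mathbf{H}_{\parallel x}-\mathbf{h}_\perp^t\overline{\mathbf{u}}-\overline{\mathbf{u}}^t\mathbf{h}_\perp=0.\tag{d}$$ Then: (i) Seek an algebraic reduction $\mathbf{H}_\parallel=\alpha\,\mathbf{h}_\perp^t\mathbf{h}_\perp$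 with a coefficient $\alpha(\mathrm{h}_\parallel,\mathrm{h}_\perp)\in\mathbb{C}$. Substituting this into (d), using (a) and (b) to eliminate $x$-derivatives of $\mathrm{h}_\perp,\mathbf{h}_\perp$, and setting to zero the coefficients of $\mathbf{h}_\perp^t\mathbf{h}_\perp$ and of $\overline{\mathbf{u}}^t\mathbf{h}_\perp+\mathbf{h}_\perp^t\overline{\mathbf{u}}$ gives $$\alpha_x-2\alpha^2(\mathbf{h}_\perp\mathbf{u}^t)-2\alpha\mathrm{u}=0,\qquad \alpha\mathrm{h}_\parallel+\alpha\mathrm{h}_\perp-1=0.$$ The second equation gives $$\alpha=\frac{1}{\mathrm{h}_\parallel+\mathrm{h}_\perp}=\frac{\mathrm{h}_\parallel-\mathrm{h}_\perp}{\mathrm{h}_\parallel^2+|\mathrm{h}_\perp|^2},$$ and the first equation then holds identically. Hence $$\mathbf{H}_\parallel=\frac{1}{\mathrm{h}_\parallel+\mathrm{h}_\perp}\,\mathbf{h}_\perp^t\mathbf{h}_\perp=\frac{\mathrm{h}_\parallel-\mathrm{h}_\perp}{\mathrm{h}_\parallel^2+|\mathrm{h}_\perp|^2}\,\mathbf{h}_\perp^t\mathbf{h}_\perp.$$ (ii) The system (a)–(d) admits the conservation law $$D_x\bigl(\mathrm{h}_\parallel^2+|\mathbf{H}_\parallel|^2-\mathrm{h}_\perp^2+2|\mathbf{h}_\perp|^2\bigr)=0,\qquad |\mathbf{H}_\parallel|^2=\mathrm{tr}(\mathbf{H}_\parallel\overline{\mathbf{H}}_\parallel).$$ (iii) Under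 the reduction in (i), with the conserved quantity in (ii) set equal to $1$, one has $$|\alpha|^{-2}+|\alpha|^2|\mathbf{h}_\perp|^4+2|\mathbf{h}_\perp|^2=1,\qquad |\alpha|^{-2}=-\bigl(|\mathbf{h}_\perp|^2-\tfrac12\bigr)\pm\tfrac12\sqrt{1-4|\mathbf{h}_\perp|^2},\qquad \mathrm{h}_\parallel=\pm\sqrt{|\alpha|^{-2}-|\mathrm{h}_\perp|^2}.$$ Taking the $x$-derivative of the flow equation for $(\mathrm{u}_t,\mathbf{u}_t)$ and substituting these expressions for $\mathrm{h}_\parallel$ and $\mathbf{H}_\parallel$ gives (with the factor $1/\sqrt\chi$ absorbed by a rescaling of $t$) the hyperbolic system $$\mathrm{u}_{tx}=-4\mathrm{u}A+4i\,\mathrm{Im}\langle\mathbf{u}_t,\mathbf{u}\rangle,$$ $$\mathbf{u}_{tx}=-|\mathbf{u}|^2\,\frac{A-\tfrac12\mathrm{u}_t}{A^2+\tfrac14|\mathrm{u}_t|^2}\,\mathbf{u}_t+A\mathbf{u}-\mathrm{u}\mathbf{u}_t-\tfrac12\mathrm{u}_t\mathbf{u},$$ in which $$A:=\mathrm{h}_\parallel=\pm\tfrac{1}{\sqrt2}\sqrt{1-2|\mathbf{u}_t|^2+\tfrac14\mathrm{u}_t^2\pm\sqrt{1-4|\mathbf{u}_t|^2}}.$$ (iv) This system is invariant under the unitary group $U(n-1)$, which acts by $(\mathrm{u},\mathbf{u})\mapsto(\mathrm{u},\mathbf{u}R^{-1})$ for all matrices $R\in U(n-1)$.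
   Context: $\langle\mathbf{a},\mathbf{b}\rangle=\overline{\mathbf{a}}\mathbf{b}^t$ and $|\mathbf{a}|^2=\langle\mathbf{a},\mathbf{a}\rangle$ for row vectors $\mathbf{a},\mathbf{b}\in\mathbb{C}^{n-1}$; $D_x$ is the total $x$-derivative; $^t$ on vectors and matrices denotes transpose. Non-bold $\mathrm{h}_\perp$, $\mathrm{u}$ are the imaginary scalars, bold $\mathbf{h}_\perp$, $\mathbf{u}$ the complex vectors. Origin of the equations: they are the Cartan structure equations of a $U(n)$-parallel frame for a non-stretching curve flow in the Hermitian symmetric space $Sp(n)/U(n)$ in which the perp part $\varpi^\perp$ of the connection component along the flow vanishes (the flow in the kernel of the symplectic operator); $(\mathrm{u},\mathbf{u})$ are the components of the connection along the curve, and $(\mathrm{h}_\parallel,\mathbf{H}_\parallel)$ and $(\mathrm{h}_\perp,\mathbf{h}_\perp)$ are the parallel and perpendicular components of the flow vector, identified with the complex symmetric $n\times n$ matrix $h=\begin{pmatrix}\mathrm{h}_\parallel+\mathrm{h}_\perp & \mathbf{h}_\perp\\ \mathbf{h}_\perp^t & \mathbf{H}_\parallel\end{pmatrix}$. The conservation law in (ii) is equivalently $D_x\langle h,h\rangle=0$, where here $\langle\cdot,\cdot\rangle$ is the Cartan–Killing form of $\mathfrak{sp}(n)$ restricted to $\mathfrak{sp}(n)/\mathfrak{u}(n)$.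
   Formalization: In (iii) two printed formulas are corrected: ¼u_t² in A becomes ½u_t², and the vector equation becomes **u**_tx = ⟨**u**,**u**_t⟩(A+½u_t)/(A²+¼|u_t|²)**u**_t − A**u** + u**u**_t + ½u_t**u**; (iv) is stated for this corrected system. *)

theory Defs
  imports
    "HOL-Analysis.Derivative"
    "Jordan_Normal_Form.Schur_Decomposition"
    "Jordan_Normal_Form.Gauss_Jordan_Elimination"
begin

(* The vectors and matrices are those of Jordan_Normal_Form, because their dimension n - 1
   depends on n and is 0 for n = 1. *)

unbundle no vec_syntax and no inner_syntax


subsection \<open>Functions of \<open>(t, x)\<close>\<close>

definition Dt :: "(real \<times> real \<Rightarrow> 'a::real_normed_vector) \<Rightarrow> real \<times> real \<Rightarrow> 'a"
  where "Dt f p = vector_derivative (\<lambda>s. f (s, snd p)) (at (fst p))"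

definition Dx :: "(real \<times> real \<Rightarrow> 'a::real_normed_vector) \<Rightarrow> real \<times> real \<Rightarrow> 'a"
  where "Dx f p = vector_derivative (\<lambda>y. f (fst p, y)) (at (snd p))"

fun Ck_on :: "nat \<Rightarrow> (real \<times> real) set \<Rightarrow> (real \<times> real \<Rightarrow> 'a::real_normed_vector) \<Rightarrow> bool"
  where
    "Ck_on 0 S f = continuous_on S f"
  | "Ck_on (Suc k) S f = (f differentiable_on S \<and> Ck_on k S (Dt f) \<and> Ck_on k S (Dx f))"

(* Used for open S only. *)
definition smooth_fun :: "(real \<times> real) set \<Rightarrow> (real \<times> real \<Rightarrow> 'a::real_normed_vector) \<Rightarrow> bool"
  where "smooth_fun S f \<longleftrightarrow> (\<forall>k. Ck_on k S f)"

definition smooth_vec :: "nat \<Rightarrow> (real \<times> real) set \<Rightarrow> (real \<times> real \<Rightarrow> complex vec) \<Rightarrow> bool"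
  where "smooth_vec m S v \<longleftrightarrow>
    (\<forall>p\<in>S. v p \<in> carrier_vec m) \<and> (\<forall>i<m. smooth_fun S (\<lambda>p. v p $ i))"

definition smooth_mat :: "nat \<Rightarrow> (real \<times> real) set \<Rightarrow> (real \<times> real \<Rightarrow> complex mat) \<Rightarrow> bool"
  where "smooth_mat m S M \<longleftrightarrow>
    (\<forall>p\<in>S. M p \<in> carrier_mat m m) \<and> (\<forall>i<m. \<forall>j<m. smooth_fun S (\<lambda>p. M p $$ (i, j)))"

definition DtV :: "(real \<times> real \<Rightarrow> complex vec) \<Rightarrow> real \<times> real \<Rightarrow> complex vec"
  where "DtV v p = vec (dim_vec (v p)) (\<lambda>i. Dt (\<lambda>q. v q $ i) p)"

definition DxV :: "(real \<times> real \<Rightarrow> complex vec) \<Rightarrow> real \<times> real \<Rightarrow> complex vec"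
  where "DxV v p = vec (dim_vec (v p)) (\<lambda>i. Dx (\<lambda>q. v q $ i) p)"

definition DxM :: "(real \<times> real \<Rightarrow> complex mat) \<Rightarrow> real \<times> real \<Rightarrow> complex mat"
  where "DxM M p = mat (dim_row (M p)) (dim_col (M p)) (\<lambda>ij. Dx (\<lambda>q. M q $$ ij) p)"


subsection \<open>Row vectors and matrices\<close>

(* \<open>cdot a b\<close> is conj(a) b^t, conjugate-linear in the first argument; the library's
   \<open>a \<bullet>c b\<close> is conjugate-linear in the second one. *)
definition cdot :: "complex vec \<Rightarrow> complex vec \<Rightarrow> complex"
  where "cdot a b = conjugate a \<bullet> b"

definition normsq :: "complex vec \<Rightarrow> real"
  where "normsq a = Re (cdot a a)"

lemma cdot_self: "cdot a a = complex_of_real (normsq a)"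
proof -
  have "Im (cdot a a) = 0"
    by (simp add: cdot_def scalar_prod_def)
  then show ?thesis
    by (simp add: normsq_def complex_eq_iff)
qed

definition outer :: "complex vec \<Rightarrow> complex vec \<Rightarrow> complex mat"
  where "outer a b = mat (dim_vec a) (dim_vec b) (\<lambda>(i, j). a $ i * b $ j)"

definition row_mult :: "complex vec \<Rightarrow> complex mat \<Rightarrow> complex vec"
  where "row_mult v M = transpose_mat M *\<^sub>v v"

definition mtrace :: "complex mat \<Rightarrow> complex"
  where "mtrace M = (\<Sum>i<dim_row M. M $$ (i, i))"

definition unitary_group :: "nat \<Rightarrow> complex mat set"
  where "unitary_group m = {R \<in> carrier_mat m m. R * mat_adjoint R = 1\<^sub>m m}"

definition unitary_action :: "complex mat \<Rightarrow> complex vec \<Rightarrow> complex vec"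
  where "unitary_action R v = row_mult v (the (mat_inverse R))"


subsection \<open>The SG flow\<close>

(* Arguments: us, uv are the scalar and the vector u; hp is h_parallel; hs, hv are the scalar
   and the vector h_perp; H is H_parallel. *)

definition imaginary_on :: "(real \<times> real) set \<Rightarrow> (real \<times> real \<Rightarrow> complex) \<Rightarrow> bool"
  where "imaginary_on S f \<longleftrightarrow> (\<forall>p\<in>S. Re (f p) = 0)"

definition sg_unknowns ::
  "nat \<Rightarrow> (real \<times> real) set \<Rightarrow> (real \<times> real \<Rightarrow> complex) \<Rightarrow> (real \<times> real \<Rightarrow> complex vec) \<Rightarrow> bool"
  where "sg_unknowns n S us uv \<longleftrightarrow>
    smooth_fun S us \<and> imaginary_on S us \<and> smooth_vec (n - 1) S uv"

definition sg_variables ::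
  "nat \<Rightarrow> (real \<times> real) set \<Rightarrow> (real \<times> real \<Rightarrow> complex) \<Rightarrow> (real \<times> real \<Rightarrow> complex vec)
    \<Rightarrow> (real \<times> real \<Rightarrow> real) \<Rightarrow> (real \<times> real \<Rightarrow> complex) \<Rightarrow> (real \<times> real \<Rightarrow> complex vec)
    \<Rightarrow> (real \<times> real \<Rightarrow> complex mat) \<Rightarrow> bool"
  where "sg_variables n S us uv hp hs hv H \<longleftrightarrow>
    sg_unknowns n S us uv \<and> sg_unknowns n S hs hv \<and> smooth_fun S hp \<and>
    smooth_mat (n - 1) S H \<and> (\<forall>p\<in>S. transpose_mat (H p) = H p)"

definition chi :: "nat \<Rightarrow> real"
  where "chi n = 8 * (real n + 1)"

definition flow_eqs ::
  "nat \<Rightarrow> (real \<times> real) set \<Rightarrow> (real \<times> real \<Rightarrow> complex) \<Rightarrow> (real \<times> real \<Rightarrow> complex vec)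
    \<Rightarrow> (real \<times> real \<Rightarrow> complex) \<Rightarrow> (real \<times> real \<Rightarrow> complex vec) \<Rightarrow> bool"
  where "flow_eqs n S us uv hs hv \<longleftrightarrow>
    (\<forall>p\<in>S. Dt us p = complex_of_real (2 / sqrt (chi n)) * hs p \<and>
      DtV uv p = complex_of_real (- 1 / sqrt (chi n)) \<cdot>\<^sub>v conjugate (hv p))"

definition eq_a ::
  "(real \<times> real) set \<Rightarrow> (real \<times> real \<Rightarrow> complex) \<Rightarrow> (real \<times> real \<Rightarrow> complex vec)
    \<Rightarrow> (real \<times> real \<Rightarrow> real) \<Rightarrow> (real \<times> real \<Rightarrow> complex) \<Rightarrow> (real \<times> real \<Rightarrow> complex vec) \<Rightarrow> bool"
  where "eq_a S us uv hp hs hv \<longleftrightarrow> (\<forall>p\<in>S.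
    Dx hs p + 2 * us p * complex_of_real (hp p) + hv p \<bullet> uv p
      - conjugate (hv p) \<bullet> conjugate (uv p) = 0)"

definition eq_b ::
  "nat \<Rightarrow> (real \<times> real) set \<Rightarrow> (real \<times> real \<Rightarrow> complex) \<Rightarrow> (real \<times> real \<Rightarrow> complex vec)
    \<Rightarrow> (real \<times> real \<Rightarrow> real) \<Rightarrow> (real \<times> real \<Rightarrow> complex) \<Rightarrow> (real \<times> real \<Rightarrow> complex vec)
    \<Rightarrow> (real \<times> real \<Rightarrow> complex mat) \<Rightarrow> bool"
  where "eq_b n S us uv hp hs hv H \<longleftrightarrow> (\<forall>p\<in>S.
    DxV hv p + row_mult (uv p) (H p) - complex_of_real (hp p) \<cdot>\<^sub>v conjugate (uv p)
      + us p \<cdot>\<^sub>v hv p - hs p \<cdot>\<^sub>v conjugate (uv p) = 0\<^sub>v (n - 1))"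

definition eq_c ::
  "(real \<times> real) set \<Rightarrow> (real \<times> real \<Rightarrow> complex) \<Rightarrow> (real \<times> real \<Rightarrow> complex vec)
    \<Rightarrow> (real \<times> real \<Rightarrow> real) \<Rightarrow> (real \<times> real \<Rightarrow> complex) \<Rightarrow> (real \<times> real \<Rightarrow> complex vec) \<Rightarrow> bool"
  where "eq_c S us uv hp hs hv \<longleftrightarrow> (\<forall>p\<in>S.
    complex_of_real (Dx hp p) + 2 * hs p * us p + hv p \<bullet> uv p
      + conjugate (hv p) \<bullet> conjugate (uv p) = 0)"

definition lhs_d ::
  "(real \<times> real \<Rightarrow> complex vec) \<Rightarrow> (real \<times> real \<Rightarrow> complex vec) \<Rightarrow> (real \<times> real \<Rightarrow> complex mat)
    \<Rightarrow> real \<times> real \<Rightarrow> complex mat"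
  where "lhs_d uv hv H p =
    DxM H p - outer (hv p) (conjugate (uv p)) - outer (conjugate (uv p)) (hv p)"

definition eq_d ::
  "nat \<Rightarrow> (real \<times> real) set \<Rightarrow> (real \<times> real \<Rightarrow> complex vec) \<Rightarrow> (real \<times> real \<Rightarrow> complex vec)
    \<Rightarrow> (real \<times> real \<Rightarrow> complex mat) \<Rightarrow> bool"
  where "eq_d n S uv hv H \<longleftrightarrow> (\<forall>p\<in>S. lhs_d uv hv H p = 0\<^sub>m (n - 1) (n - 1))"


subsection \<open>Algebraic reduction and conserved density\<close>

definition reduced ::
  "(real \<times> real) set \<Rightarrow> (real \<times> real \<Rightarrow> complex) \<Rightarrow> (real \<times> real \<Rightarrow> complex vec)
    \<Rightarrow> (real \<times> real \<Rightarrow> complex mat) \<Rightarrow> bool"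
  where "reduced S \<alpha> hv H \<longleftrightarrow> (\<forall>p\<in>S. H p = \<alpha> p \<cdot>\<^sub>m outer (hv p) (hv p))"

definition coeff1 ::
  "(real \<times> real \<Rightarrow> complex) \<Rightarrow> (real \<times> real \<Rightarrow> complex) \<Rightarrow> (real \<times> real \<Rightarrow> complex vec)
    \<Rightarrow> (real \<times> real \<Rightarrow> complex vec) \<Rightarrow> real \<times> real \<Rightarrow> complex"
  where "coeff1 \<alpha> us uv hv p = Dx \<alpha> p - 2 * (\<alpha> p)\<^sup>2 * (hv p \<bullet> uv p) - 2 * \<alpha> p * us p"

definition coeff2 ::
  "(real \<times> real \<Rightarrow> complex) \<Rightarrow> (real \<times> real \<Rightarrow> real) \<Rightarrow> (real \<times> real \<Rightarrow> complex)
    \<Rightarrow> real \<times> real \<Rightarrow> complex"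
  where "coeff2 \<alpha> hp hs p = \<alpha> p * complex_of_real (hp p) + \<alpha> p * hs p - 1"

definition density ::
  "(real \<times> real \<Rightarrow> real) \<Rightarrow> (real \<times> real \<Rightarrow> complex) \<Rightarrow> (real \<times> real \<Rightarrow> complex vec)
    \<Rightarrow> (real \<times> real \<Rightarrow> complex mat) \<Rightarrow> real \<times> real \<Rightarrow> complex"
  where "density hp hs hv H p =
    (complex_of_real (hp p))\<^sup>2 + mtrace (H p * map_mat cnj (H p)) - (hs p)\<^sup>2
      + 2 * cdot (hv p) (hv p)"


subsection \<open>The hyperbolic system\<close>

definition rescale_t :: "real \<Rightarrow> (real \<times> real \<Rightarrow> 'a) \<Rightarrow> real \<times> real \<Rightarrow> 'a"
  where "rescale_t c f = (\<lambda>p. f (c * fst p, snd p))"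

definition rescale_dom :: "real \<Rightarrow> (real \<times> real) set \<Rightarrow> (real \<times> real) set"
  where "rescale_dom c S = {p. (c * fst p, snd p) \<in> S}"

definition sign_fun :: "(real \<times> real \<Rightarrow> real) \<Rightarrow> bool"
  where "sign_fun \<sigma> \<longleftrightarrow> (\<forall>p. \<sigma> p = 1 \<or> \<sigma> p = - 1)"

(* \<open>ut\<close> is imaginary, so \<open>ut\<^sup>2\<close> is real. With us_t = 2 hs and uv_t = - conj(hv),
   A is the expression \<open>\<sigma>\<close> sqrt(1/|\<alpha>|^2 - |hs|^2), where
   1/|\<alpha>|^2 = 1/2 - |hv|^2 + \<open>\<epsilon>\<close>/2 sqrt(1 - 4|hv|^2); this yields the coefficient 1/2 of ut^2. *)
definition sg_radicand :: "real \<Rightarrow> complex \<Rightarrow> complex vec \<Rightarrow> real"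
  where "sg_radicand \<epsilon> ut uvt =
    1 - 2 * normsq uvt + 1 / 2 * Re (ut\<^sup>2) + \<epsilon> * sqrt (1 - 4 * normsq uvt)"

definition sg_A :: "real \<Rightarrow> real \<Rightarrow> complex \<Rightarrow> complex vec \<Rightarrow> real"
  where "sg_A \<sigma> \<epsilon> ut uvt = \<sigma> * (1 / sqrt 2) * sqrt (sg_radicand \<epsilon> ut uvt)"

(* \<open>\<sigma>\<close> is the outer and \<open>\<epsilon>\<close> the inner sign in the formula for A; each may vary with the point.
   The first three conjuncts say that both radicands are nonnegative and the denominator
   is nonzero, i.e. that the expressions in the system make sense. The last equation is
   minus the conjugate of (b) with H = hv^t hv / (A + hs), hs = ut/2 and hv = - conj(uvt):
   the factor of uvt in it is cdot uv uvt / (A - hs). *)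
definition sg_system ::
  "(real \<times> real) set \<Rightarrow> (real \<times> real \<Rightarrow> real) \<Rightarrow> (real \<times> real \<Rightarrow> real)
    \<Rightarrow> (real \<times> real \<Rightarrow> complex) \<Rightarrow> (real \<times> real \<Rightarrow> complex vec) \<Rightarrow> bool"
  where "sg_system S \<sigma> \<epsilon> us uv \<longleftrightarrow> (\<forall>p\<in>S.
    let ut = Dt us p; uvt = DtV uv p; A = sg_A (\<sigma> p) (\<epsilon> p) ut uvt in
      1 - 4 * normsq uvt \<ge> 0 \<and>
      sg_radicand (\<epsilon> p) ut uvt \<ge> 0 \<and>
      A\<^sup>2 + 1 / 4 * (cmod ut)\<^sup>2 \<noteq> 0 \<and>
      Dx (Dt us) p = - 4 * us p * complex_of_real A
        + 4 * \<i> * complex_of_real (Im (cdot uvt (uv p))) \<and>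
      DxV (DtV uv) p =
        (cdot (uv p) uvt * ((complex_of_real A + 1 / 2 * ut)
            / complex_of_real (A\<^sup>2 + 1 / 4 * (cmod ut)\<^sup>2))) \<cdot>\<^sub>v uvt
        - complex_of_real A \<cdot>\<^sub>v uv p + us p \<cdot>\<^sub>v uvt + (1 / 2 * ut) \<cdot>\<^sub>v uv p)"

end

(* Equations (a) and (c) add up to a Riccati equation for g = h_parallel + h_perp, whose reciprocal
   satisfies exactly the first coefficient equation; this is why the reduction is consistent
   with (d). With X = 1/|alpha|^2 = h_parallel^2 + |h_perp|^2 the normalised conservation law
   is the quadratic X^2 - (1 - 2|bold h_perp|^2) X + |bold h_perp|^4 = 0, and the hyperbolic
   system consists of (a) and minus the conjugate of (b) after the flow equations have been used.
   The unitary action is v |-> U v with U the entrywise conjugate of R, which preserves all inner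
   products, commutes with both derivatives and is injective. *)

theory Submission
  imports Defs
begin

subsection \<open>Partial derivatives\<close>

text \<open>The data are total functions on the plane about which something is known only on the
  open set \<open>S\<close>, and \<open>Dx\<close>, \<open>Dt\<close> are choice terms that mean
  something only where the derivative exists. Every computation therefore obtains a genuine
  derivative along a coordinate line and carries identities valid on \<open>S\<close> over to it,
  using that such lines meet \<open>S\<close> in open sets. The second derivatives of the hyperbolic
  system arise by differentiating the flow equations in this way. The system closes because the
  reduced H has rank one: its squared norm is |\<alpha>|^2 times the fourth power of the norm of
  \<open>hv\<close>, so unit density leaves 1/|\<alpha>|^2 as the only unknown. The factor
  1/sqrt(\<open>chi n\<close>) disappears by a dilation of t, which replaces \<open>S\<close> by
  \<open>rescale_dom\<close>.\<close>

lemma open_slice_x: "open S \<Longrightarrow> open {y. (a, y) \<in> S}"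
  for S :: "(real \<times> real) set"
  using open_vimage[of S "\<lambda>y. (a, y)"] by (simp add: vimage_def continuous_on_Pair)

lemma open_slice_t: "open S \<Longrightarrow> open {s. (s, b) \<in> S}"
  for S :: "(real \<times> real) set"
  using open_vimage[of S "\<lambda>s. (s, b)"] by (simp add: vimage_def continuous_on_Pair)

text \<open>Joint differentiability gives differentiability along the horizontal line by the chain
  rule, so the choice behind \<open>Dx\<close> picks an actual derivative.\<close>

lemma Dx_works:
  assumes "open S" "p \<in> S" "f differentiable_on S"
  shows "((\<lambda>y. f (fst p, y)) has_vector_derivative Dx f p) (at (snd p))"
proof -
  have "f differentiable (at (fst p, snd p))"
    using assms differentiable_on_eq_differentiable_at by auto
  moreover have "(\<lambda>y. (fst p, y)) differentiable (at (snd p))"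
    by (auto intro!: derivative_eq_intros simp: differentiable_def)
  ultimately have "(\<lambda>y. f (fst p, y)) differentiable (at (snd p))"
    using differentiable_chain_at[of "\<lambda>y. (fst p, y)" "snd p" f] by (simp add: o_def)
  then show ?thesis
    by (simp add: Dx_def vector_derivative_works)
qed

lemma Dt_works:
  assumes "open S" "p \<in> S" "f differentiable_on S"
  shows "((\<lambda>s. f (s, snd p)) has_vector_derivative Dt f p) (at (fst p))"
proof -
  have "f differentiable (at (fst p, snd p))"
    using assms differentiable_on_eq_differentiable_at by auto
  moreover have "(\<lambda>s. (s, snd p)) differentiable (at (fst p))"
    by (auto intro!: derivative_eq_intros simp: differentiable_def)
  ultimately have "(\<lambda>s. f (s, snd p)) differentiable (at (fst p))"
    using differentiable_chain_at[of "\<lambda>s. (s, snd p)" "fst p" f] by (simp add: o_def)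
  then show ?thesis
    by (simp add: Dt_def vector_derivative_works)
qed

text \<open>A derivative depends only on values near the point, and the line through
  \<open>p\<close> stays in the open set \<open>S\<close> for a while; agreement on \<open>S\<close>
  is therefore enough.\<close>

lemma Dx_eqI:
  assumes "open S" "p \<in> S" "\<And>q. q \<in> S \<Longrightarrow> f q = g q"
    and "((\<lambda>y. g (fst p, y)) has_vector_derivative D) (at (snd p))"
  shows "((\<lambda>y. f (fst p, y)) has_vector_derivative D) (at (snd p))" "Dx f p = D"
proof -
  show "((\<lambda>y. f (fst p, y)) has_vector_derivative D) (at (snd p))"
    by (rule has_vector_derivative_transform_within_open[OF assms(4) open_slice_x[OF assms(1), of "fst p"]])
      (use assms(2,3) in auto)
  then show "Dx f p = D"
    by (simp add: Dx_def vector_derivative_at)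
qed

lemma Dt_eqI:
  assumes "open S" "p \<in> S" "\<And>q. q \<in> S \<Longrightarrow> f q = g q"
    and "((\<lambda>s. g (s, snd p)) has_vector_derivative D) (at (fst p))"
  shows "Dt f p = D"
proof -
  have "((\<lambda>s. f (s, snd p)) has_vector_derivative D) (at (fst p))"
    by (rule has_vector_derivative_transform_within_open[OF assms(4) open_slice_t[OF assms(1), of "snd p"]])
      (use assms(2,3) in auto)
  then show ?thesis
    by (simp add: Dt_def vector_derivative_at)
qed

section \<open>Closure properties of smooth functions on an open set\<close>

lemma differentiable_on_cong:
  assumes "f differentiable_on S" "\<And>q. q \<in> S \<Longrightarrow> f q = g q"
  shows "g differentiable_on S"
  unfolding differentiable_on_def
proof
  fix q assume q: "q \<in> S"
  then obtain D where "(f has_derivative D) (at q within S)"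
    using assms(1) by (auto simp: differentiable_on_def differentiable_def)
  then have "(g has_derivative D) (at q within S)"
    by (rule has_derivative_transform[rotated 2]) (use q assms(2) in auto)
  then show "g differentiable at q within S"
    by (auto simp: differentiable_def)
qed

lemma smooth_fun_imp_differentiable_on: "smooth_fun S f \<Longrightarrow> f differentiable_on S"
  using Ck_on.simps(2)[of 0 S f] by (auto simp: smooth_fun_def)

lemma smooth_fun_Dt: "smooth_fun S f \<Longrightarrow> smooth_fun S (Dt f)"
  by (metis Ck_on.simps(2) smooth_fun_def)

text \<open>Derivative rules yield equations between functions on \<open>S\<close> only, never
  equality of total functions. This congruence lets an induction over \<open>k\<close> use
  them.\<close>

lemma Ck_on_cong:
  assumes "open S" "Ck_on k S f" "\<And>q. q \<in> S \<Longrightarrow> f q = g q"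
  shows "Ck_on k S g"
  using assms(2,3)
proof (induction k arbitrary: f g)
  case 0
  then show ?case
    using continuous_on_cong[of S S f g] by simp
next
  case (Suc k)
  have "Dt f q = Dt g q" "Dx f q = Dx g q" if "q \<in> S" for q
  proof -
    have "Dt g q = Dt f q"
      by (rule Dt_eqI[OF assms(1) that, of g f]) (use Suc.prems Dt_works[OF assms(1) that, of f] in simp_all)
    moreover have "Dx g q = Dx f q"
      by (rule Dx_eqI(2)[OF assms(1) that, of g f]) (use Suc.prems Dx_works[OF assms(1) that, of f] in simp_all)
    ultimately show "Dt f q = Dt g q" "Dx f q = Dx g q" by simp_all
  qed
  then have "Ck_on k S (Dt g)" "Ck_on k S (Dx g)"
    using Suc.prems(1) by (auto intro: Suc.IH)
  then show ?case
    using Suc.prems differentiable_on_cong[of f S g] by simp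
qed

text \<open>The sum rule identifies \<open>Dt\<close> and \<open>Dx\<close> of the sum on
  \<open>S\<close> only, so the induction hypothesis has to pass through
  \<open>Ck_on_cong\<close>.\<close>

lemma Ck_on_add:
  assumes "open S" "Ck_on k S f" "Ck_on k S g"
  shows "Ck_on k S (\<lambda>q. f q + g q)"
  using assms(2,3)
proof (induction k arbitrary: f g)
  case 0
  then show ?case by (simp add: continuous_on_add)
next
  case (Suc k)
  have "Dt f q + Dt g q = Dt (\<lambda>q. f q + g q) q" "Dx f q + Dx g q = Dx (\<lambda>q. f q + g q) q"
    if "q \<in> S" for q
    using has_vector_derivative_add[OF Dt_works[OF assms(1) that] Dt_works[OF assms(1) that], of f g]
      has_vector_derivative_add[OF Dx_works[OF assms(1) that] Dx_works[OF assms(1) that], of f g]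
      Suc.prems by (simp_all add: Dt_def Dx_def vector_derivative_at)
  then have "Ck_on k S (Dt (\<lambda>q. f q + g q))" "Ck_on k S (Dx (\<lambda>q. f q + g q))"
    using Suc.prems by (auto intro: Ck_on_cong[OF assms(1) Suc.IH])
  then show ?case
    using Suc.prems by (simp add: differentiable_on_add)
qed

lemma Ck_on_cmult:
  fixes f :: "real \<times> real \<Rightarrow> 'a::real_normed_algebra"
  assumes "open S" "Ck_on k S f"
  shows "Ck_on k S (\<lambda>q. c * f q)"
  using assms(2)
proof (induction k arbitrary: f)
  case 0
  then show ?case by (simp add: continuous_on_mult)
next
  case (Suc k)
  have "c * Dt f q = Dt (\<lambda>q. c * f q) q" "c * Dx f q = Dx (\<lambda>q. c * f q) q"
    if "q \<in> S" for q
    using has_vector_derivative_mult_right[OF Dt_works[OF assms(1) that], of f c]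
      has_vector_derivative_mult_right[OF Dx_works[OF assms(1) that], of f c]
      Suc.prems by (simp_all add: Dt_def Dx_def vector_derivative_at)
  then have "Ck_on k S (Dt (\<lambda>q. c * f q))" "Ck_on k S (Dx (\<lambda>q. c * f q))"
    using Suc.prems by (auto intro: Ck_on_cong[OF assms(1) Suc.IH])
  then show ?case
    using Suc.prems by (simp add: differentiable_on_mult)
qed

lemma Ck_on_zero: "open S \<Longrightarrow> Ck_on k S (\<lambda>q. 0)"
  by (induction k) (simp_all add: Dt_def[abs_def] Dx_def[abs_def])

text \<open>Linear combinations with constant coefficients are the components of a constant matrix
  applied to a smooth vector.\<close>

lemma smooth_fun_sum_cmult:
  fixes f :: "'i \<Rightarrow> real \<times> real \<Rightarrow> 'a::real_normed_algebra"
  assumes "open S" "finite I" "\<And>i. i \<in> I \<Longrightarrow> smooth_fun S (f i)"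
  shows "smooth_fun S (\<lambda>q. \<Sum>i\<in>I. c i * f i q)"
  using assms(2,3)
proof (induction I rule: finite_induct)
  case empty
  then show ?case using assms(1) by (simp add: smooth_fun_def Ck_on_zero)
next
  case (insert i I)
  then show ?case
    using assms(1) by (auto simp: smooth_fun_def intro!: Ck_on_add Ck_on_cmult)
qed

lemma Dx_sum_cmult:
  fixes f :: "'i \<Rightarrow> real \<times> real \<Rightarrow> 'a::real_normed_algebra"
  assumes "open S" "p \<in> S" "\<And>i. i \<in> I \<Longrightarrow> smooth_fun S (f i)"
    and "\<And>q. q \<in> S \<Longrightarrow> g q = (\<Sum>i\<in>I. c i * f i q)"
  shows "Dx g p = (\<Sum>i\<in>I. c i * Dx (f i) p)"
  by (rule Dx_eqI(2)[OF assms(1,2,4)])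
    (auto intro!: has_vector_derivative_sum has_vector_derivative_mult_right
        Dx_works[OF assms(1,2)] smooth_fun_imp_differentiable_on assms(3))

lemma Dt_sum_cmult:
  fixes f :: "'i \<Rightarrow> real \<times> real \<Rightarrow> 'a::real_normed_algebra"
  assumes "open S" "p \<in> S" "\<And>i. i \<in> I \<Longrightarrow> smooth_fun S (f i)"
    and "\<And>q. q \<in> S \<Longrightarrow> g q = (\<Sum>i\<in>I. c i * f i q)"
  shows "Dt g p = (\<Sum>i\<in>I. c i * Dt (f i) p)"
  by (rule Dt_eqI[OF assms(1,2,4)])
    (auto intro!: has_vector_derivative_sum has_vector_derivative_mult_right
        Dt_works[OF assms(1,2)] smooth_fun_imp_differentiable_on assms(3))


subsection \<open>Rescaling of time\<close>

lemma open_rescale_dom: "open S \<Longrightarrow> open (rescale_dom c S)"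
  using open_vimage[of S "\<lambda>p. (c * fst p, snd p)"]
  by (simp add: rescale_dom_def vimage_def continuous_on_Pair continuous_on_mult continuous_on_fst continuous_on_snd)

lemma Dt_rescale:
  assumes "open S" "f differentiable_on S" "p \<in> rescale_dom c S"
  shows "Dt (rescale_t c f) p = c *\<^sub>R Dt f (c * fst p, snd p)"
proof -
  have "((\<lambda>s. f (s, snd p)) has_vector_derivative Dt f (c * fst p, snd p)) (at (c * fst p))"
    using Dt_works[OF assms(1) _ assms(2), of "(c * fst p, snd p)"] assms(3)
    by (simp add: rescale_dom_def)
  moreover have "((\<lambda>s. c * s) has_vector_derivative c) (at (fst p))"
    by (auto intro!: derivative_eq_intros)
  ultimately have "((\<lambda>s. f (c * s, snd p)) has_vector_derivative c *\<^sub>R Dt f (c * fst p, snd p))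
      (at (fst p))"
    using vector_diff_chain_at[of "\<lambda>s. c * s" c "fst p" "\<lambda>s. f (s, snd p)"]
    by (simp add: o_def)
  then show ?thesis
    by (simp add: Dt_def rescale_t_def vector_derivative_at)
qed


subsection \<open>Unitary invariance\<close>

lemma smooth_vecD:
  assumes "smooth_vec m S v"
  shows "p \<in> S \<Longrightarrow> v p \<in> carrier_vec m" "p \<in> S \<Longrightarrow> dim_vec (v p) = m"
    "i < m \<Longrightarrow> smooth_fun S (\<lambda>p. v p $ i)"
  using assms by (auto simp: smooth_vec_def)

lemma smooth_fun_cong:
  assumes "open S" "smooth_fun S f" "\<And>q. q \<in> S \<Longrightarrow> f q = g q"
  shows "smooth_fun S g"
  using assms(2) Ck_on_cong[OF assms(1) _ assms(3)] by (auto simp: smooth_fun_def)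

lemma DtV_carrier: "v p \<in> carrier_vec m \<Longrightarrow> DtV v p \<in> carrier_vec m"
  by (auto simp: DtV_def)

lemma DxV_carrier: "v p \<in> carrier_vec m \<Longrightarrow> DxV v p \<in> carrier_vec m"
  by (auto simp: DxV_def)

lemma smooth_vec_DtV:
  assumes "open S" "smooth_vec m S v"
  shows "smooth_vec m S (DtV v)"
proof -
  have 1: "DtV v p \<in> carrier_vec m" if "p \<in> S" for p
    using smooth_vecD(1)[OF assms(2) that] by (rule DtV_carrier)
  have 2: "smooth_fun S (\<lambda>p. DtV v p $ i)" if "i < m" for i
  proof (rule smooth_fun_cong[OF assms(1) smooth_fun_Dt[OF smooth_vecD(3)[OF assms(2) that]]])
    fix q assume "q \<in> S"
    then have "dim_vec (v q) = m" by (rule smooth_vecD(2)[OF assms(2)])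
    then show "Dt (\<lambda>p. v p $ i) q = DtV v q $ i" using that by (simp add: DtV_def)
  qed
  show ?thesis
    unfolding smooth_vec_def using 1 2 by blast
qed

lemma mult_mat_vec_nth:
  assumes "U \<in> carrier_mat k m" "v \<in> carrier_vec m" "i < k"
  shows "(U *\<^sub>v v) $ i = (\<Sum>j = 0..<m. U $$ (i, j) * v $ j)"
  using assms by (auto simp: scalar_prod_def intro!: sum.cong)

lemma smooth_vec_mult_mat:
  assumes "open S" "smooth_vec m S v" "U \<in> carrier_mat m m"
  shows "smooth_vec m S (\<lambda>p. U *\<^sub>v v p)"
proof -
  have 1: "U *\<^sub>v v p \<in> carrier_vec m" if "p \<in> S" for p
    using assms(3) smooth_vecD(1)[OF assms(2) that] by simp
  have 2: "smooth_fun S (\<lambda>p. (U *\<^sub>v v p) $ i)" if "i < m" for i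
  proof (rule smooth_fun_cong[OF assms(1)])
    show "smooth_fun S (\<lambda>p. \<Sum>j = 0..<m. U $$ (i, j) * v p $ j)"
      by (rule smooth_fun_sum_cmult[OF assms(1)]) (simp_all add: smooth_vecD(3)[OF assms(2)])
    show "(\<Sum>j = 0..<m. U $$ (i, j) * v q $ j) = (U *\<^sub>v v q) $ i" if "q \<in> S" for q
      by (rule mult_mat_vec_nth[OF assms(3) smooth_vecD(1)[OF assms(2) that] \<open>i < m\<close>, symmetric])
  qed
  show ?thesis
    unfolding smooth_vec_def using 1 2 by blast
qed

lemma DtV_mult_mat:
  assumes "open S" "smooth_vec m S v" "U \<in> carrier_mat m m"
    and "\<And>q. q \<in> S \<Longrightarrow> w q = U *\<^sub>v v q" "p \<in> S"
  shows "DtV w p = U *\<^sub>v DtV v p"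
proof (rule eq_vecI)
  have dim: "dim_vec (v p) = m" and carr: "DtV v p \<in> carrier_vec m"
    using smooth_vecD(1,2)[OF assms(2,5)] by (simp_all add: DtV_carrier)
  show "dim_vec (DtV w p) = dim_vec (U *\<^sub>v DtV v p)"
    using assms(3) assms(4)[OF assms(5)] by (simp add: DtV_def)
  fix i assume "i < dim_vec (U *\<^sub>v DtV v p)"
  then have i: "i < m" using assms(3) by simp
  have "Dt (\<lambda>q. w q $ i) p = (\<Sum>j = 0..<m. U $$ (i, j) * Dt (\<lambda>q. v q $ j) p)"
  proof (rule Dt_sum_cmult[OF assms(1,5)])
    show "smooth_fun S (\<lambda>q. v q $ j)" if "j \<in> {0..<m}" for j
      using smooth_vecD(3)[OF assms(2), of j] that by simp
    show "w q $ i = (\<Sum>j = 0..<m. U $$ (i, j) * v q $ j)" if "q \<in> S" for q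
      unfolding assms(4)[OF that] by (rule mult_mat_vec_nth[OF assms(3) smooth_vecD(1)[OF assms(2) that] i])
  qed
  then show "DtV w p $ i = (U *\<^sub>v DtV v p) $ i"
    unfolding mult_mat_vec_nth[OF assms(3) carr i]
    using assms(3) assms(4)[OF assms(5)] i dim by (simp add: DtV_def)
qed

text \<open>Agreement of \<open>w\<close> with the product is asked on \<open>S\<close> only because
  the lemma is later applied to a time derivative, for which nothing is known outside
  \<open>S\<close>.\<close>

lemma DxV_mult_mat:
  assumes "open S" "smooth_vec m S v" "U \<in> carrier_mat m m"
    and "\<And>q. q \<in> S \<Longrightarrow> w q = U *\<^sub>v v q" "p \<in> S"
  shows "DxV w p = U *\<^sub>v DxV v p"
proof (rule eq_vecI)
  have dim: "dim_vec (v p) = m" and carr: "DxV v p \<in> carrier_vec m"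
    using smooth_vecD(1,2)[OF assms(2,5)] by (simp_all add: DxV_carrier)
  show "dim_vec (DxV w p) = dim_vec (U *\<^sub>v DxV v p)"
    using assms(3) assms(4)[OF assms(5)] by (simp add: DxV_def)
  fix i assume "i < dim_vec (U *\<^sub>v DxV v p)"
  then have i: "i < m" using assms(3) by simp
  have "Dx (\<lambda>q. w q $ i) p = (\<Sum>j = 0..<m. U $$ (i, j) * Dx (\<lambda>q. v q $ j) p)"
  proof (rule Dx_sum_cmult[OF assms(1,5)])
    show "smooth_fun S (\<lambda>q. v q $ j)" if "j \<in> {0..<m}" for j
      using smooth_vecD(3)[OF assms(2), of j] that by simp
    show "w q $ i = (\<Sum>j = 0..<m. U $$ (i, j) * v q $ j)" if "q \<in> S" for q
      unfolding assms(4)[OF that] by (rule mult_mat_vec_nth[OF assms(3) smooth_vecD(1)[OF assms(2) that] i])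
  qed
  then show "DxV w p $ i = (U *\<^sub>v DxV v p) $ i"
    unfolding mult_mat_vec_nth[OF assms(3) carr i]
    using assms(3) assms(4)[OF assms(5)] i dim by (simp add: DxV_def)
qed

section \<open>Inner products and the system under an isometry\<close>

lemma cdot_eq_sum:
  "a \<in> carrier_vec m \<Longrightarrow> b \<in> carrier_vec m \<Longrightarrow> cdot a b = (\<Sum>i = 0..<m. cnj (a $ i) * b $ i)"
  by (auto simp: cdot_def scalar_prod_def intro!: sum.cong)

lemma cdot_mult_mat:
  assumes U: "U \<in> carrier_mat m m" and iso: "mat_adjoint U * U = 1\<^sub>m m"
    and a: "a \<in> carrier_vec m" and b: "b \<in> carrier_vec m"
  shows "cdot (U *\<^sub>v a) (U *\<^sub>v b) = cdot a b"
proof -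
  \<comment> \<open>Entrywise form of \<open>iso\<close>: the columns of \<open>U\<close> are
    orthonormal.\<close>
  have delta: "(\<Sum>i = 0..<m. cnj (U $$ (i, j)) * U $$ (i, k)) = (if j = k then 1 else 0)"
    if "j < m" "k < m" for j k
  proof -
    have "(mat_adjoint U * U) $$ (j, k) = (\<Sum>i = 0..<m. cnj (U $$ (i, j)) * U $$ (i, k))"
      using U that by (auto simp: mat_adjoint_def scalar_prod_def intro!: sum.cong)
    then show ?thesis
      using that by (simp add: iso)
  qed
  have "cdot (U *\<^sub>v a) (U *\<^sub>v b)
      = (\<Sum>i = 0..<m. cnj (\<Sum>j = 0..<m. U $$ (i, j) * a $ j) * (\<Sum>k = 0..<m. U $$ (i, k) * b $ k))"
    using U a b by (simp add: cdot_eq_sum[of _ m] mult_mat_vec_nth[of _ m m] del: index_mult_mat_vec)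
  also have "\<dots> = (\<Sum>i = 0..<m. \<Sum>j = 0..<m. \<Sum>k = 0..<m.
      cnj (U $$ (i, j)) * cnj (a $ j) * (U $$ (i, k) * b $ k))"
    by (simp add: sum_product)
  \<comment> \<open>Two exchanges bring the row index \<open>i\<close> innermost, where
    \<open>delta\<close> applies.\<close>
  also have "\<dots> = (\<Sum>j = 0..<m. \<Sum>i = 0..<m. \<Sum>k = 0..<m.
      cnj (U $$ (i, j)) * cnj (a $ j) * (U $$ (i, k) * b $ k))"
    by (rule sum.swap)
  also have "\<dots> = (\<Sum>j = 0..<m. \<Sum>k = 0..<m. \<Sum>i = 0..<m.
      cnj (U $$ (i, j)) * cnj (a $ j) * (U $$ (i, k) * b $ k))"
    by (rule sum.cong[OF refl], rule sum.swap)
  also have "\<dots> = (\<Sum>j = 0..<m. \<Sum>k = 0..<m.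
      cnj (a $ j) * b $ k * (\<Sum>i = 0..<m. cnj (U $$ (i, j)) * U $$ (i, k)))"
    by (simp add: sum_distrib_left mult_ac)
  also have "\<dots> = (\<Sum>j = 0..<m. \<Sum>k = 0..<m. if j = k then cnj (a $ j) * b $ k else 0)"
    by (intro sum.cong refl) (simp add: delta)
  also have "\<dots> = cdot a b"
    using a b by (simp add: cdot_eq_sum)
  finally show ?thesis .
qed

text \<open>All scalar coefficients depend on the vectors only through inner products, which
  \<open>U\<close> preserves. Each vector term is multiplied by \<open>U\<close>, and injectivity of
  \<open>U\<close> allows it to be cancelled, which gives the equivalence.\<close>

lemma sg_system_mult_mat:
  assumes "open S" "smooth_vec m S v"
    and U: "U \<in> carrier_mat m m" and iso: "mat_adjoint U * U = 1\<^sub>m m"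
  shows "sg_system S \<sigma> \<epsilon> us (\<lambda>p. U *\<^sub>v v p) \<longleftrightarrow> sg_system S \<sigma> \<epsilon> us v"
proof -
  define w where "w = (\<lambda>p. U *\<^sub>v v p)"
  have adj: "mat_adjoint U \<in> carrier_mat m m"
    using U by (auto simp: mat_adjoint_def)
  have inj: "U *\<^sub>v a = U *\<^sub>v b \<longleftrightarrow> a = b" if "a \<in> carrier_vec m" "b \<in> carrier_vec m" for a b
  proof
    assume "U *\<^sub>v a = U *\<^sub>v b"
    then have "mat_adjoint U * U *\<^sub>v a = mat_adjoint U * U *\<^sub>v b"
      using that by (simp add: assoc_mult_mat_vec[OF adj U])
    then show "a = b" using that by (simp add: iso)
  qed simp
  have vt: "smooth_vec m S (DtV v)"
    by (rule smooth_vec_DtV[OF assms(1,2)])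
  have wt: "DtV w q = U *\<^sub>v DtV v q" if "q \<in> S" for q
    by (rule DtV_mult_mat[OF assms(1,2) U _ that]) (simp add: w_def)
  have wtx: "DxV (DtV w) q = U *\<^sub>v DxV (DtV v) q" if "q \<in> S" for q
    by (rule DxV_mult_mat[OF assms(1) vt U wt that])
  have cdot: "cdot (DtV w p) (w p) = cdot (DtV v p) (v p)" "cdot (w p) (DtV w p) = cdot (v p) (DtV v p)"
    "normsq (DtV w p) = normsq (DtV v p)" if "p \<in> S" for p
    using wt[OF that] smooth_vecD(1)[OF assms(2) that] smooth_vecD(1)[OF vt that]
    by (simp_all add: w_def normsq_def cdot_mult_mat[OF U iso])
  have A: "sg_radicand e z (DtV w p) = sg_radicand e z (DtV v p)"
    "sg_A s e z (DtV w p) = sg_A s e z (DtV v p)" if "p \<in> S" for p s e z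
    by (simp_all add: sg_A_def sg_radicand_def cdot[OF that])
  \<comment> \<open>Arbitrary coefficients keep the quotient in the vector equation out of the
    argument; it is matched afterwards by \<open>cdot\<close> and \<open>A\<close>.\<close>
  have "DxV (DtV w) p = c \<cdot>\<^sub>v DtV w p - a \<cdot>\<^sub>v w p + d \<cdot>\<^sub>v DtV w p + e \<cdot>\<^sub>v w p
      \<longleftrightarrow> DxV (DtV v) p = c \<cdot>\<^sub>v DtV v p - a \<cdot>\<^sub>v v p + d \<cdot>\<^sub>v DtV v p + e \<cdot>\<^sub>v v p"
    if "p \<in> S" for p c a d e
  proof -
    note [simp] = smooth_vecD(1)[OF assms(2) that] smooth_vecD(1)[OF vt that]
    have [simp]: "DxV (DtV v) p \<in> carrier_vec m"
      using smooth_vecD(1)[OF vt that] by (rule DxV_carrier)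
    have "c \<cdot>\<^sub>v DtV w p - a \<cdot>\<^sub>v w p + d \<cdot>\<^sub>v DtV w p + e \<cdot>\<^sub>v w p
        = U *\<^sub>v (c \<cdot>\<^sub>v DtV v p - a \<cdot>\<^sub>v v p + d \<cdot>\<^sub>v DtV v p + e \<cdot>\<^sub>v v p)"
      unfolding wt[OF that] using U by (simp add: w_def mult_add_distrib_mat_vec[OF U]
          mult_minus_distrib_mat_vec[OF U] mult_mat_vec[OF U])
    then show ?thesis
      unfolding wtx[OF that] using U by (simp add: inj)
  qed
  then show ?thesis
    unfolding sg_system_def w_def[symmetric] Let_def
    by (intro ball_cong refl) (simp only: cdot A)
qed

section \<open>Unitary matrices and their action on row vectors\<close>

lemma mat_adjoint_dim: "dim_row (mat_adjoint A) = dim_col A" "dim_col (mat_adjoint A) = dim_row A"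
  by (simp_all add: mat_adjoint_def)

lemma mat_adjoint_nth:
  "i < dim_col A \<Longrightarrow> j < dim_row A \<Longrightarrow> mat_adjoint A $$ (i, j) = conjugate (A $$ (j, i))"
  by (simp add: mat_adjoint_def mat_of_rows_def)

lemma unitary_group_left_inverse:
  assumes "R \<in> unitary_group m"
  shows "R \<in> carrier_mat m m" "mat_adjoint R \<in> carrier_mat m m"
    "R * mat_adjoint R = 1\<^sub>m m" "mat_adjoint R * R = 1\<^sub>m m"
proof -
  show R: "R \<in> carrier_mat m m" "R * mat_adjoint R = 1\<^sub>m m"
    using assms by (auto simp: unitary_group_def)
  then show "mat_adjoint R \<in> carrier_mat m m"
    by (auto simp: mat_adjoint_def)
  then show "mat_adjoint R * R = 1\<^sub>m m"
    using mat_mult_left_right_inverse R by blast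
qed

text \<open>\<open>mat_inverse\<close> returns an option computed by elimination. A two-sided
  inverse makes \<open>A\<close> a unit, which excludes \<open>None\<close>; uniqueness of inverses
  then identifies the result with \<open>B\<close>.\<close>

lemma mat_inverse_eqI:
  fixes A :: "'a::field mat"
  assumes A: "A \<in> carrier_mat m m" and B: "B \<in> carrier_mat m m"
    and AB: "A * B = 1\<^sub>m m"
  shows "mat_inverse A = Some B"
proof -
  have BA: "B * A = 1\<^sub>m m"
    by (rule mat_mult_left_right_inverse[OF A B AB])
  have "A \<in> Units (ring_mat TYPE('a) m ())"
    using A B AB BA by (auto simp: Units_def ring_mat_def)
  then obtain C where C: "mat_inverse A = Some C"
    using mat_inverse(1)[OF A, of "()"] by (cases "mat_inverse A") auto
  then have "C * A = 1\<^sub>m m" "C \<in> carrier_mat m m"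
    using mat_inverse(2)[OF A] by auto
  then have "C = B"
    using assoc_mult_mat[of C m m A m B m] A B AB by simp
  then show ?thesis using C by simp
qed

lemma unitary_action_eq:
  assumes "R \<in> unitary_group m"
  shows "unitary_action R v = transpose_mat (mat_adjoint R) *\<^sub>v v"
  using unitary_group_left_inverse[OF assms]
  by (simp add: unitary_action_def row_mult_def mat_inverse_eqI[of R m "mat_adjoint R"])

text \<open>The adjoint of \<open>U\<close> is the transpose of \<open>R\<close>, so the product in
  question is the transpose of \<open>mat_adjoint R * R\<close>.\<close>

lemma unitary_action_mat:
  assumes "R \<in> unitary_group m"
  defines "U \<equiv> transpose_mat (mat_adjoint R)"
  shows "U \<in> carrier_mat m m" "mat_adjoint U * U = 1\<^sub>m m"
proof -
  note R = unitary_group_left_inverse[OF assms(1)]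
  show U: "U \<in> carrier_mat m m"
    using R by (simp add: U_def)
  have "mat_adjoint U = transpose_mat R"
    using R(1,2) by (intro eq_matI) (auto simp: U_def mat_adjoint_nth mat_adjoint_dim)
  then have "mat_adjoint U * U = transpose_mat (mat_adjoint R * R)"
    using transpose_mult[OF R(2,1)] by (simp add: U_def)
  then show "mat_adjoint U * U = 1\<^sub>m m"
    using R(4) by simp
qed

text \<open>Right multiplication of rows reverses the order of factors and so does inversion;
  together they give a left action.\<close>

lemma unitary_action_mult:
  assumes R: "R \<in> unitary_group m" and R': "R' \<in> unitary_group m" and v: "v \<in> carrier_vec m"
  shows "unitary_action (R * R') v = unitary_action R (unitary_action R' v)"
proof -
  note 1 = unitary_group_left_inverse[OF R] and 2 = unitary_group_left_inverse[OF R']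
  have "(R * R') * (mat_adjoint R' * mat_adjoint R) = R * (R' * mat_adjoint R') * mat_adjoint R"
    using 1(1,2) 2(1,2) by (simp add: assoc_mult_mat[of _ m m _ m _ m])
  also have "\<dots> = 1\<^sub>m m"
    using 1 2 by simp
  finally have "mat_inverse (R * R') = Some (mat_adjoint R' * mat_adjoint R)"
    using 1 2 by (intro mat_inverse_eqI[of _ m]) auto
  then have "unitary_action (R * R') v
      = (transpose_mat (mat_adjoint R) * transpose_mat (mat_adjoint R')) *\<^sub>v v"
    using transpose_mult[OF 2(2) 1(2)] by (simp add: unitary_action_def row_mult_def)
  also have "\<dots> = unitary_action R (unitary_action R' v)"
    using 1 2 v by (simp add: unitary_action_eq[OF R] unitary_action_eq[OF R'])
  finally show ?thesis .
qed

lemma unitary_action_one: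
  assumes "v \<in> carrier_vec m"
  shows "unitary_action (1\<^sub>m m) v = v"
  using assms mat_inverse_eqI[of "1\<^sub>m m" m "1\<^sub>m m :: complex mat"]
  by (simp add: unitary_action_def row_mult_def)


subsection \<open>The structure equations in components\<close>

text \<open>For imaginary \<open>s\<close> the conjugate of h + s is h - s, so both formulas compute
  the squared modulus of h + s.\<close>

lemma hs_conj_product:
  assumes "Re s = 0"
  shows "(complex_of_real h + s) * (complex_of_real h - s) = complex_of_real (h\<^sup>2 + (cmod s)\<^sup>2)"
    "(cmod (complex_of_real h + s))\<^sup>2 = h\<^sup>2 + (cmod s)\<^sup>2"
  using assms by (simp_all add: complex_eq_iff cmod_power2) (simp add: power2_eq_square algebra_simps)

lemma inverse_hs:
  assumes "Re s = 0" "complex_of_real h + s \<noteq> 0"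
  shows "1 / (complex_of_real h + s) = (complex_of_real h - s) / complex_of_real (h\<^sup>2 + (cmod s)\<^sup>2)"
    "h\<^sup>2 + (cmod s)\<^sup>2 \<noteq> 0"
proof -
  show nz: "h\<^sup>2 + (cmod s)\<^sup>2 \<noteq> 0"
    using assms(2) unfolding hs_conj_product(2)[OF assms(1), symmetric] by simp
  then show "1 / (complex_of_real h + s) = (complex_of_real h - s) / complex_of_real (h\<^sup>2 + (cmod s)\<^sup>2)"
    using assms(2) hs_conj_product(1)[OF assms(1), of h]
    by (metis mult_eq_0_iff of_real_eq_0_iff nonzero_divide_mult_cancel_right)
qed

text \<open>Only the types of the variables are fixed here: smoothness, reality and symmetry. The
  equations stay hypotheses of the single lemmas because the claims assume different selections of
  them.\<close>

locale sg_setting =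
  fixes n :: nat and S :: "(real \<times> real) set"
    and us :: "real \<times> real \<Rightarrow> complex" and uv :: "real \<times> real \<Rightarrow> complex vec"
    and hp :: "real \<times> real \<Rightarrow> real"
    and hs :: "real \<times> real \<Rightarrow> complex" and hv :: "real \<times> real \<Rightarrow> complex vec"
    and H :: "real \<times> real \<Rightarrow> complex mat"
  assumes open_S: "open S" and variables: "sg_variables n S us uv hp hs hv H"
begin

abbreviation m :: nat where "m \<equiv> n - 1"

lemma smooth:
  "smooth_fun S us" "smooth_vec m S uv" "smooth_fun S hp"
  "smooth_fun S hs" "smooth_vec m S hv" "smooth_mat m S H"
  using variables by (auto simp: sg_variables_def sg_unknowns_def)

lemma imaginary: "p \<in> S \<Longrightarrow> Re (us p) = 0" "p \<in> S \<Longrightarrow> Re (hs p) = 0"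
  using variables by (auto simp: sg_variables_def sg_unknowns_def imaginary_on_def)

lemma cnj_imaginary: "p \<in> S \<Longrightarrow> cnj (us p) = - us p" "p \<in> S \<Longrightarrow> cnj (hs p) = - hs p"
  using imaginary by (simp_all add: complex_eq_iff)

lemma carrier:
  assumes "p \<in> S"
  shows "uv p \<in> carrier_vec m" "hv p \<in> carrier_vec m" "H p \<in> carrier_mat m m"
    "dim_vec (uv p) = m" "dim_vec (hv p) = m" "dim_row (H p) = m" "dim_col (H p) = m"
  using smooth assms by (auto simp: smooth_vec_def smooth_mat_def)

lemma H_sym:
  assumes "p \<in> S" "i < m" "j < m"
  shows "H p $$ (i, j) = H p $$ (j, i)"
proof -
  have "transpose_mat (H p) $$ (j, i) = H p $$ (j, i)"
    using variables assms(1) by (simp add: sg_variables_def)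
  then show ?thesis
    using carrier(6,7)[OF assms(1)] assms(2,3) by simp
qed

text \<open>The real function \<open>hp\<close> is embedded into the complex numbers so that one
  product rule serves all variables.\<close>

lemma has_Dx:
  assumes "p \<in> S"
  shows "((\<lambda>y. complex_of_real (hp (fst p, y))) has_vector_derivative complex_of_real (Dx hp p)) (at (snd p))"
    "((\<lambda>y. hs (fst p, y)) has_vector_derivative Dx hs p) (at (snd p))"
    "i < m \<Longrightarrow> ((\<lambda>y. hv (fst p, y) $ i) has_vector_derivative Dx (\<lambda>q. hv q $ i) p) (at (snd p))"
    "i < m \<Longrightarrow> j < m \<Longrightarrow> ((\<lambda>y. H (fst p, y) $$ (i, j)) has_vector_derivative
      Dx (\<lambda>q. H q $$ (i, j)) p) (at (snd p))"
proof -
  note D = Dx_works[OF open_S assms smooth_fun_imp_differentiable_on]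
  show "((\<lambda>y. complex_of_real (hp (fst p, y))) has_vector_derivative complex_of_real (Dx hp p)) (at (snd p))"
    using D[OF smooth(3)]
    by (intro has_vector_derivative_of_real)
      (simp add: has_real_derivative_iff_has_vector_derivative)
  show "((\<lambda>y. hs (fst p, y)) has_vector_derivative Dx hs p) (at (snd p))"
    by (rule D[OF smooth(4)])
  show "((\<lambda>y. hv (fst p, y) $ i) has_vector_derivative Dx (\<lambda>q. hv q $ i) p) (at (snd p))" if "i < m"
    using D[of "\<lambda>q. hv q $ i"] smooth(5) that by (simp add: smooth_vec_def)
  show "((\<lambda>y. H (fst p, y) $$ (i, j)) has_vector_derivative Dx (\<lambda>q. H q $$ (i, j)) p) (at (snd p))"
    if "i < m" "j < m"
    using D[of "\<lambda>q. H q $$ (i, j)"] smooth(6) that by (simp add: smooth_mat_def)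
qed

section \<open>Equations (a) to (d) solved for the x-derivatives\<close>

lemma conj_dot:
  "p \<in> S \<Longrightarrow> conjugate (hv p) \<bullet> conjugate (uv p) = cnj (hv p \<bullet> uv p)"
  using conjugate_sprod_vec[of "hv p" m "uv p"] carrier by simp

lemma dot_eq_sum: "p \<in> S \<Longrightarrow> hv p \<bullet> uv p = (\<Sum>j = 0..<m. hv p $ j * uv p $ j)"
  using carrier(4) by (simp add: scalar_prod_def)

lemma Dx_hs:
  assumes "eq_a S us uv hp hs hv" "p \<in> S"
  shows "Dx hs p = - 2 * us p * complex_of_real (hp p) - hv p \<bullet> uv p + cnj (hv p \<bullet> uv p)"
proof -
  have "Dx hs p + 2 * us p * complex_of_real (hp p) + hv p \<bullet> uv p - cnj (hv p \<bullet> uv p) = 0"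
    using assms by (simp add: eq_a_def conj_dot)
  then show ?thesis by Groebner_Basis.algebra
qed

lemma Dx_hp:
  assumes "eq_c S us uv hp hs hv" "p \<in> S"
  shows "complex_of_real (Dx hp p) = - 2 * hs p * us p - hv p \<bullet> uv p - cnj (hv p \<bullet> uv p)"
proof -
  have "complex_of_real (Dx hp p) + 2 * hs p * us p + hv p \<bullet> uv p + cnj (hv p \<bullet> uv p) = 0"
    using assms by (simp add: eq_c_def conj_dot)
  then show ?thesis by Groebner_Basis.algebra
qed

lemma Dx_hv:
  assumes "eq_b n S us uv hp hs hv H" "p \<in> S" "i < m"
  shows "Dx (\<lambda>q. hv q $ i) p = (complex_of_real (hp p) + hs p) * cnj (uv p $ i)
    - us p * hv p $ i - (\<Sum>j = 0..<m. H p $$ (j, i) * uv p $ j)"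
proof -
  have dims: "dim_vec (uv p) = m" "dim_vec (hv p) = m" "dim_row (H p) = m" "dim_col (H p) = m"
    using carrier[OF assms(2)] by auto
  have row: "row_mult (uv p) (H p) $ i = (\<Sum>j = 0..<m. H p $$ (j, i) * uv p $ j)"
    using dims assms(3) by (auto simp: row_mult_def scalar_prod_def intro!: sum.cong)
  have "(DxV hv p + row_mult (uv p) (H p) - complex_of_real (hp p) \<cdot>\<^sub>v conjugate (uv p)
      + us p \<cdot>\<^sub>v hv p - hs p \<cdot>\<^sub>v conjugate (uv p)) $ i = 0"
    using assms by (simp add: eq_b_def)
  moreover have "DxV hv p $ i = Dx (\<lambda>q. hv q $ i) p"
    using dims assms(3) by (simp add: DxV_def)
  moreover have "dim_vec (row_mult (uv p) (H p)) = m"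
    using dims by (simp add: row_mult_def)
  ultimately have "Dx (\<lambda>q. hv q $ i) p + (\<Sum>j = 0..<m. H p $$ (j, i) * uv p $ j)
      - complex_of_real (hp p) * cnj (uv p $ i) + us p * hv p $ i - hs p * cnj (uv p $ i) = 0"
    using dims assms(3) row by simp
  then show ?thesis by Groebner_Basis.algebra
qed

lemma lhs_d_nth:
  assumes "p \<in> S" "i < m" "j < m"
  shows "lhs_d uv hv H p $$ (i, j)
    = Dx (\<lambda>q. H q $$ (i, j)) p - hv p $ i * cnj (uv p $ j) - cnj (uv p $ i) * hv p $ j"
  using carrier[OF assms(1)] assms(2,3) by (simp add: lhs_d_def DxM_def outer_def)

lemma Dx_H:
  assumes "eq_d n S uv hv H" "p \<in> S" "i < m" "j < m"
  shows "Dx (\<lambda>q. H q $$ (i, j)) p = hv p $ i * cnj (uv p $ j) + cnj (uv p $ i) * hv p $ j"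
proof -
  have "lhs_d uv hv H p $$ (i, j) = 0"
    using assms by (simp add: eq_d_def)
  then show ?thesis
    unfolding lhs_d_nth[OF assms(2-4)] by Groebner_Basis.algebra
qed


subsection \<open>Algebraic reduction\<close>

lemma reduced_nth:
  assumes "reduced S \<alpha> hv H" "p \<in> S" "i < m" "j < m"
  shows "H p $$ (i, j) = \<alpha> p * (hv p $ i * hv p $ j)"
  using assms carrier(5)[OF assms(2)] by (simp add: reduced_def outer_def)

text \<open>A rank-one H sends u to a multiple of \<open>hv\<close>, so the H term of (b) merges
  with the term containing the scalar u.\<close>

lemma Dx_hv_reduced:
  assumes "reduced S \<alpha> hv H" "eq_b n S us uv hp hs hv H" "p \<in> S" "i < m"
  shows "Dx (\<lambda>q. hv q $ i) p = (complex_of_real (hp p) + hs p) * cnj (uv p $ i)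
    - (us p + \<alpha> p * (hv p \<bullet> uv p)) * hv p $ i"
proof -
  have "(\<Sum>j = 0..<m. H p $$ (j, i) * uv p $ j) = \<alpha> p * (hv p \<bullet> uv p) * hv p $ i"
    using assms by (simp add: dot_eq_sum reduced_nth sum_distrib_left sum_distrib_right mult_ac)
  then show ?thesis
    unfolding Dx_hv[OF assms(2-4)] by (simp add: algebra_simps)
qed

text \<open>Leibniz rule for \<alpha> h_i h_j, with (b) inserted for both vector factors. Each
  contributes -\<alpha> u - \<alpha>^2 (h u^t) to the first coefficient, hence the factors 2 there;
  their conj(u) parts form the symmetric pair with weight \<alpha> (h_parallel + h_perp), from which
  (d) subtracts 1.\<close>

lemma lhs_d_reduced:
  assumes "((\<lambda>y. \<alpha> (fst p, y)) has_vector_derivative Dx \<alpha> p) (at (snd p))"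
    and red: "reduced S \<alpha> hv H" and b: "eq_b n S us uv hp hs hv H" and p: "p \<in> S"
  shows "lhs_d uv hv H p = coeff1 \<alpha> us uv hv p \<cdot>\<^sub>m outer (hv p) (hv p)
    + coeff2 \<alpha> hp hs p \<cdot>\<^sub>m (outer (conjugate (uv p)) (hv p) + outer (hv p) (conjugate (uv p)))"
proof (rule eq_matI)
  note c = carrier[OF p]
  fix i j assume "i < dim_row (coeff1 \<alpha> us uv hv p \<cdot>\<^sub>m outer (hv p) (hv p)
    + coeff2 \<alpha> hp hs p \<cdot>\<^sub>m (outer (conjugate (uv p)) (hv p) + outer (hv p) (conjugate (uv p))))"
    "j < dim_col (coeff1 \<alpha> us uv hv p \<cdot>\<^sub>m outer (hv p) (hv p)
    + coeff2 \<alpha> hp hs p \<cdot>\<^sub>m (outer (conjugate (uv p)) (hv p) + outer (hv p) (conjugate (uv p))))"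
  then have ij: "i < m" "j < m"
    using c by (auto simp: outer_def)
  define v where "v = hv p"
  define w where "w = uv p"
  define vx where "vx k = Dx (\<lambda>q. hv q $ k) p" for k
  have "((\<lambda>y. \<alpha> (fst p, y) * (hv (fst p, y) $ i * hv (fst p, y) $ j)) has_vector_derivative
      \<alpha> p * (v $ i * vx j + vx i * v $ j) + Dx \<alpha> p * (v $ i * v $ j)) (at (snd p))"
    using has_vector_derivative_mult[OF assms(1)
        has_vector_derivative_mult[OF has_Dx(3)[OF p ij(1)] has_Dx(3)[OF p ij(2)]]]
    by (simp add: v_def vx_def)
  then have "Dx (\<lambda>q. H q $$ (i, j)) p
      = \<alpha> p * (v $ i * vx j + vx i * v $ j) + Dx \<alpha> p * (v $ i * v $ j)"
    by (intro Dx_eqI(2)[OF open_S p, of _ "\<lambda>q. \<alpha> q * (hv q $ i * hv q $ j)"])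
      (use red ij reduced_nth in auto)
  moreover have "vx k = (complex_of_real (hp p) + hs p) * cnj (w $ k) - (us p + \<alpha> p * (v \<bullet> w)) * v $ k"
    if "k < m" for k
    unfolding vx_def v_def w_def by (rule Dx_hv_reduced[OF red b p that])
  ultimately have "lhs_d uv hv H p $$ (i, j) =
      coeff1 \<alpha> us uv hv p * (v $ i * v $ j)
      + coeff2 \<alpha> hp hs p * (cnj (w $ i) * v $ j + v $ i * cnj (w $ j))"
    unfolding lhs_d_nth[OF p ij] using ij
    by (simp add: coeff1_def coeff2_def v_def[symmetric] w_def[symmetric] power2_eq_square algebra_simps)
  then show "lhs_d uv hv H p $$ (i, j) = (coeff1 \<alpha> us uv hv p \<cdot>\<^sub>m outer (hv p) (hv p)
    + coeff2 \<alpha> hp hs p \<cdot>\<^sub>m (outer (conjugate (uv p)) (hv p) + outer (hv p) (conjugate (uv p)))) $$ (i, j)"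
    using c ij by (simp add: outer_def v_def w_def)
qed (use carrier[OF p] in \<open>auto simp: lhs_d_def DxM_def outer_def\<close>)

text \<open>Since division by zero yields zero, the formula for \<alpha> is equivalent to the
  equation only together with the nonvanishing of the denominator.\<close>

lemma coeff2_eq_0_iff:
  "coeff2 \<alpha> hp hs p = 0 \<longleftrightarrow> complex_of_real (hp p) + hs p \<noteq> 0 \<and>
    \<alpha> p = 1 / (complex_of_real (hp p) + hs p)"
proof -
  have "coeff2 \<alpha> hp hs p = \<alpha> p * (complex_of_real (hp p) + hs p) - 1"
    by (simp add: coeff2_def algebra_simps)
  moreover have "z * g - 1 = 0 \<longleftrightarrow> g \<noteq> 0 \<and> z = 1 / g" for z g :: complex
    by (auto simp: eq_divide_eq)
  ultimately show ?thesis by simp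
qed

text \<open>On \<open>S\<close> the second coefficient equation makes \<alpha> the inverse of a
  differentiable nonvanishing function, which supplies both the existence of its x-derivative and
  the value.\<close>

lemma Dx_alpha:
  assumes "\<And>q. q \<in> S \<Longrightarrow> coeff2 \<alpha> hp hs q = 0"
    and "eq_a S us uv hp hs hv" "eq_c S us uv hp hs hv" "p \<in> S"
  shows "((\<lambda>y. \<alpha> (fst p, y)) has_vector_derivative Dx \<alpha> p) (at (snd p))"
    "coeff1 \<alpha> us uv hv p = 0"
proof -
  define g where "g = (\<lambda>q. complex_of_real (hp q) + hs q)"
  have \<alpha>: "g q \<noteq> 0 \<and> \<alpha> q = inverse (g q)" if "q \<in> S" for q
    using assms(1)[OF that] unfolding coeff2_eq_0_iff g_def by (auto simp: field_simps)
  define g' where "g' = complex_of_real (Dx hp p) + Dx hs p"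
  have "((\<lambda>y. g (fst p, y)) has_vector_derivative g') (at (snd p))"
    unfolding g_def g'_def by (intro has_vector_derivative_add has_Dx assms(4))
  moreover have "(inverse has_field_derivative - (inverse (g p))\<^sup>2) (at (g (fst p, snd p)))"
    using DERIV_inverse[of "g p"] \<alpha>[OF assms(4)] by (simp add: numeral_2_eq_2)
  ultimately have "((\<lambda>y. inverse (g (fst p, y))) has_vector_derivative g' * - (inverse (g p))\<^sup>2) (at (snd p))"
    using field_vector_diff_chain_at[of "\<lambda>y. g (fst p, y)" g' "snd p" inverse "- (inverse (g p))\<^sup>2"]
    by (simp add: o_def)
  note D = Dx_eqI[OF open_S assms(4) _ this, of \<alpha>]
  have "Dx \<alpha> p = g' * - (inverse (g p))\<^sup>2"
    by (rule D(2)) (use \<alpha> in auto)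
  moreover show "((\<lambda>y. \<alpha> (fst p, y)) has_vector_derivative Dx \<alpha> p) (at (snd p))"
    unfolding calculation by (rule D(1)) (use \<alpha> in auto)
  \<comment> \<open>The conjugate terms of (a) and (c) have opposite signs and cancel in the
    sum.\<close>
  moreover have "g' = - 2 * us p * g p - 2 * (hv p \<bullet> uv p)"
    unfolding g'_def g_def Dx_hs[OF assms(2,4)] Dx_hp[OF assms(3,4)] by (simp add: algebra_simps)
  ultimately show "coeff1 \<alpha> us uv hv p = 0"
    using \<alpha>[OF assms(4)] by (simp add: coeff1_def field_simps power2_eq_square)
qed

lemma alpha_H_eq:
  assumes "coeff2 \<alpha> hp hs p = 0" "reduced S \<alpha> hv H" "p \<in> S"
  shows "\<alpha> p = 1 / (complex_of_real (hp p) + hs p)"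
    "\<alpha> p = (complex_of_real (hp p) - hs p) / complex_of_real ((hp p)\<^sup>2 + (cmod (hs p))\<^sup>2)"
    "H p = (1 / (complex_of_real (hp p) + hs p)) \<cdot>\<^sub>m outer (hv p) (hv p)"
    "H p = ((complex_of_real (hp p) - hs p) / complex_of_real ((hp p)\<^sup>2 + (cmod (hs p))\<^sup>2))
      \<cdot>\<^sub>m outer (hv p) (hv p)"
proof -
  have 1: "complex_of_real (hp p) + hs p \<noteq> 0" "\<alpha> p = 1 / (complex_of_real (hp p) + hs p)"
    using assms(1) by (auto simp: coeff2_eq_0_iff)
  show "\<alpha> p = 1 / (complex_of_real (hp p) + hs p)" by (rule 1)
  show 2: "\<alpha> p = (complex_of_real (hp p) - hs p) / complex_of_real ((hp p)\<^sup>2 + (cmod (hs p))\<^sup>2)"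
    using inverse_hs(1)[OF imaginary(2)[OF assms(3)] 1(1)] 1(2) by simp
  have "H p = \<alpha> p \<cdot>\<^sub>m outer (hv p) (hv p)"
    using assms by (simp add: reduced_def)
  then show "H p = (1 / (complex_of_real (hp p) + hs p)) \<cdot>\<^sub>m outer (hv p) (hv p)"
    "H p = ((complex_of_real (hp p) - hs p) / complex_of_real ((hp p)\<^sup>2 + (cmod (hs p))\<^sup>2))
      \<cdot>\<^sub>m outer (hv p) (hv p)"
    using 1(2) 2 by simp_all
qed

lemma eq_d_reduced:
  assumes "\<And>q. q \<in> S \<Longrightarrow> coeff2 \<alpha> hp hs q = 0" "reduced S \<alpha> hv H"
    and "eq_a S us uv hp hs hv" "eq_b n S us uv hp hs hv H" "eq_c S us uv hp hs hv"
  shows "eq_d n S uv hv H"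
  unfolding eq_d_def
proof
  fix p assume p: "p \<in> S"
  have "lhs_d uv hv H p = 0 \<cdot>\<^sub>m outer (hv p) (hv p)
      + 0 \<cdot>\<^sub>m (outer (conjugate (uv p)) (hv p) + outer (hv p) (conjugate (uv p)))"
    using lhs_d_reduced[OF Dx_alpha(1)[OF assms(1,3,5) p] assms(2,4) p]
    unfolding Dx_alpha(2)[OF assms(1,3,5) p, simplified] assms(1)[OF p] by simp
  also have "\<dots> = 0\<^sub>m m m"
    using carrier[OF p] by (intro eq_matI) (auto simp: outer_def)
  finally show "lhs_d uv hv H p = 0\<^sub>m m m" .
qed


subsection \<open>Conservation law\<close>

text \<open>Symmetry of H turns the trace into the sum of the squared moduli of its entries, so each
  summand has the form z conj(z).\<close>

lemma density_eq_sum: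
  assumes "p \<in> S"
  shows "density hp hs hv H p = (complex_of_real (hp p))\<^sup>2
    + (\<Sum>i = 0..<m. \<Sum>j = 0..<m. H p $$ (i, j) * cnj (H p $$ (i, j))) - (hs p)\<^sup>2
    + 2 * (\<Sum>i = 0..<m. cnj (hv p $ i) * hv p $ i)"
proof -
  have "mtrace (H p * map_mat cnj (H p))
      = (\<Sum>i = 0..<m. \<Sum>j = 0..<m. H p $$ (i, j) * cnj (H p $$ (j, i)))"
    using carrier[OF assms]
    by (auto simp: mtrace_def scalar_prod_def atLeast0LessThan intro!: sum.cong)
  also have "\<dots> = (\<Sum>i = 0..<m. \<Sum>j = 0..<m. H p $$ (i, j) * cnj (H p $$ (i, j)))"
  proof (intro sum.cong refl)
    fix i j assume "i \<in> {0..<m}" "j \<in> {0..<m}"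
    then show "H p $$ (i, j) * cnj (H p $$ (j, i)) = H p $$ (i, j) * cnj (H p $$ (i, j))"
      using H_sym[OF assms, of j i] by simp
  qed
  finally show ?thesis
    using carrier[OF assms] by (simp add: density_def cdot_eq_sum)
qed

text \<open>The derivative is kept in the form z + conj(z), so that only one half of each term has
  to be evaluated.\<close>

lemma has_vector_derivative_mult_cnj:
  fixes f :: "real \<Rightarrow> complex"
  assumes "(f has_vector_derivative f') (at x)"
  shows "((\<lambda>y. f y * cnj (f y)) has_vector_derivative f' * cnj (f x) + cnj (f' * cnj (f x))) (at x)"
  using has_vector_derivative_mult[OF assms has_vector_derivative_cnj[OF assms]]
  by (simp add: add.commute mult.commute)

text \<open>Three cancellations occur. The couplings \<open>k\<close> of H with the vectors come
  from (d) and from (b) with opposite signs; the term in u and the norm of \<open>hv\<close> is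
  imaginary and drops out with its conjugate; the terms in \<open>q\<close> from (b) cancel those
  from (a) and (c).\<close>

lemma Dx_density:
  assumes a: "eq_a S us uv hp hs hv" and b: "eq_b n S us uv hp hs hv H"
    and c: "eq_c S us uv hp hs hv" and d: "eq_d n S uv hv H" and p: "p \<in> S"
  shows "Dx (density hp hs hv H) p = 0"
proof -
  define v where "v = hv p"
  define w where "w = uv p"
  define K where "K i j = H p $$ (i, j)" for i j
  define vx where "vx i = Dx (\<lambda>q. hv q $ i) p" for i
  define Kx where "Kx i j = Dx (\<lambda>q. H q $$ (i, j)) p" for i j
  define q where "q = v \<bullet> w"
  define N where "N = (\<Sum>i = 0..<m. v $ i * cnj (v $ i))"
  \<comment> \<open>In matrix notation this is conj(\<open>v\<close>) H \<open>w\<close>^t.\<close>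
  define k where "k = (\<Sum>i = 0..<m. \<Sum>j = 0..<m. K i j * cnj (v $ i) * w $ j)"
  let ?h = "complex_of_real (hp p)" and ?hx = "complex_of_real (Dx hp p)"
  define g where "g = (\<lambda>q. complex_of_real (hp q) * complex_of_real (hp q)
      + (\<Sum>i = 0..<m. \<Sum>j = 0..<m. H q $$ (i, j) * cnj (H q $$ (i, j))) - hs q * hs q
      + 2 * (\<Sum>i = 0..<m. hv q $ i * cnj (hv q $ i)))"
  define tH where "tH = (\<Sum>i = 0..<m. \<Sum>j = 0..<m. Kx i j * cnj (K i j))"
  define tv where "tv = (\<Sum>i = 0..<m. vx i * cnj (v $ i))"
  have "((\<lambda>y. g (fst p, y)) has_vector_derivative
      (?h * ?hx + ?hx * ?h)
      + (\<Sum>i = 0..<m. \<Sum>j = 0..<m. Kx i j * cnj (K i j) + cnj (Kx i j * cnj (K i j)))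
      - (hs p * Dx hs p + Dx hs p * hs p)
      + 2 * (\<Sum>i = 0..<m. vx i * cnj (v $ i) + cnj (vx i * cnj (v $ i)))) (at (snd p))"
    unfolding g_def v_def K_def Kx_def vx_def
    apply (intro has_vector_derivative_add has_vector_derivative_diff
        has_vector_derivative_mult_right has_vector_derivative_sum)
    subgoal using has_vector_derivative_mult[OF has_Dx(1)[OF p] has_Dx(1)[OF p]] by simp
    subgoal for i j using has_vector_derivative_mult_cnj[OF has_Dx(4)[OF p, of i j]] by simp
    subgoal using has_vector_derivative_mult[OF has_Dx(2)[OF p] has_Dx(2)[OF p]] by simp
    subgoal for i using has_vector_derivative_mult_cnj[OF has_Dx(3)[OF p, of i]] by simp
    done
  moreover have "density hp hs hv H q = g q" if "q \<in> S" for q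
    unfolding density_eq_sum[OF that] g_def by (simp add: power2_eq_square mult.commute)
  ultimately have "Dx (density hp hs hv H) p =
      (?h * ?hx + ?hx * ?h)
      + (\<Sum>i = 0..<m. \<Sum>j = 0..<m. Kx i j * cnj (K i j) + cnj (Kx i j * cnj (K i j)))
      - (hs p * Dx hs p + Dx hs p * hs p)
      + 2 * (\<Sum>i = 0..<m. vx i * cnj (v $ i) + cnj (vx i * cnj (v $ i)))"
    by (intro Dx_eqI(2)[OF open_S p, of _ g])
  also have "\<dots> = 2 * ?h * ?hx + (tH + cnj tH) - 2 * hs p * Dx hs p + 2 * (tv + cnj tv)"
    by (simp add: tH_def tv_def sum.distrib)
  \<comment> \<open>Both products in (d) contribute conj(\<open>k\<close>): the second becomes the
    first after exchanging the indices, by symmetry of H.\<close>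
  also have "tH = 2 * cnj k"
  proof -
    have K: "K i j = K j i" if "i < m" "j < m" for i j
      unfolding K_def by (rule H_sym[OF p that])
    have "tH = (\<Sum>i = 0..<m. \<Sum>j = 0..<m. cnj (K i j) * v $ i * cnj (w $ j)
        + cnj (K i j) * v $ j * cnj (w $ i))"
      unfolding tH_def
      by (intro sum.cong refl) (simp add: Kx_def Dx_H[OF d p] v_def w_def algebra_simps)
    also have "\<dots> = cnj k + (\<Sum>i = 0..<m. \<Sum>j = 0..<m. cnj (K i j) * v $ j * cnj (w $ i))"
      by (simp add: k_def sum.distrib)
    also have "(\<Sum>i = 0..<m. \<Sum>j = 0..<m. cnj (K i j) * v $ j * cnj (w $ i)) = cnj k"
      unfolding k_def by (subst sum.swap) (simp, intro sum.cong refl, simp add: K)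
    finally show ?thesis by simp
  qed
  also have "tv = (?h + hs p) * cnj q - us p * N - k"
  proof -
    have "tv = (\<Sum>i = 0..<m. (?h + hs p) * (cnj (v $ i) * cnj (w $ i)) - us p * (v $ i * cnj (v $ i))
        - (\<Sum>j = 0..<m. K i j * cnj (v $ i) * w $ j))"
      unfolding tv_def
    proof (intro sum.cong refl)
      fix i assume "i \<in> {0..<m}"
      then have i: "i < m" by simp
      have "(\<Sum>j = 0..<m. H p $$ (j, i) * uv p $ j) = (\<Sum>j = 0..<m. K i j * w $ j)"
        by (intro sum.cong refl) (simp add: K_def w_def H_sym[OF p _ i])
      then have vx: "vx i = (?h + hs p) * cnj (w $ i) - us p * v $ i - (\<Sum>j = 0..<m. K i j * w $ j)"
        unfolding vx_def Dx_hv[OF b p i] by (simp add: v_def w_def)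
      show "vx i * cnj (v $ i) = (?h + hs p) * (cnj (v $ i) * cnj (w $ i))
          - us p * (v $ i * cnj (v $ i)) - (\<Sum>j = 0..<m. K i j * cnj (v $ i) * w $ j)"
        unfolding vx by (simp add: left_diff_distrib right_diff_distrib sum_distrib_left sum_distrib_right mult_ac)
    qed
    also have "\<dots> = (?h + hs p) * cnj q - us p * N - k"
      using dot_eq_sum[OF p]
      by (simp add: q_def N_def k_def v_def w_def sum_subtractf sum_distrib_left)
    finally show ?thesis .
  qed
  \<comment> \<open>\<open>us\<close> and \<open>hs\<close> change sign under conjugation, while
    \<open>?h\<close> and \<open>N\<close> are real.\<close>
  also have "cnj ((?h + hs p) * cnj q - us p * N - k) = (?h - hs p) * q + us p * N - cnj k"
    using cnj_imaginary[OF p] by (simp add: N_def mult.commute)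
  also have "2 * ?h * ?hx + (2 * cnj k + cnj (2 * cnj k)) - 2 * hs p * Dx hs p
      + 2 * ((?h + hs p) * cnj q - us p * N - k + ((?h - hs p) * q + us p * N - cnj k)) = 0"
    unfolding Dx_hs[OF a p] Dx_hp[OF c p] by (simp add: q_def v_def w_def algebra_simps)
  finally show ?thesis .
qed

end


subsection \<open>The hyperbolic system\<close>

text \<open>Multiplying by X and completing the square gives (2X - (1 - 2N))^2 = 1 - 4N. The sign of
  the root records on which side of the midpoint 1/2 - N of the two roots X lies.\<close>

lemma quadratic_roots:
  fixes X N :: real
  assumes "X \<noteq> 0" "X + N\<^sup>2 / X + 2 * N = 1"
  shows "1 - 4 * N \<ge> 0"
    "X = - (N - 1 / 2) + (if X \<ge> 1 / 2 - N then 1 else - 1) * (1 / 2) * sqrt (1 - 4 * N)"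
proof -
  have "X\<^sup>2 + N\<^sup>2 + 2 * N * X = X"
    using assms by (simp add: field_simps power2_eq_square)
  then have sq: "(2 * X - (1 - 2 * N))\<^sup>2 = 1 - 4 * N"
    by (simp add: power2_eq_square algebra_simps)
  then show "1 - 4 * N \<ge> 0"
    by (metis zero_le_power2)
  have "sqrt (1 - 4 * N) = \<bar>2 * X - (1 - 2 * N)\<bar>"
    unfolding sq[symmetric] by simp
  then show "X = - (N - 1 / 2) + (if X \<ge> 1 / 2 - N then 1 else - 1) * (1 / 2) * sqrt (1 - 4 * N)"
    by (auto simp: abs_if field_simps)
qed

text \<open>With ut = 2s and s imaginary, half of Re(ut^2) is -2|s|^2. The radicand is then twice X
  - |s|^2, and this 2 cancels the prefactor 1/sqrt 2 of \<open>sg_A\<close>.\<close>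

lemma sg_A_eq:
  assumes "Re s = 0"
    and X: "X = - (normsq w - 1 / 2) + e * (1 / 2) * sqrt (1 - 4 * normsq w)"
    and "X - (cmod s)\<^sup>2 \<ge> 0"
  shows "sg_radicand e (2 * s) w = 2 * (X - (cmod s)\<^sup>2)"
    "sg_A \<sigma> e (2 * s) w = \<sigma> * sqrt (X - (cmod s)\<^sup>2)"
proof -
  have "Re ((2 * s)\<^sup>2) = - 4 * (cmod s)\<^sup>2"
    using assms(1) by (simp add: cmod_power2) (simp add: power2_eq_square)
  then show rad: "sg_radicand e (2 * s) w = 2 * (X - (cmod s)\<^sup>2)"
    unfolding sg_radicand_def X by (simp add: algebra_simps)
  show "sg_A \<sigma> e (2 * s) w = \<sigma> * sqrt (X - (cmod s)\<^sup>2)"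
    unfolding sg_A_def rad real_sqrt_mult by simp
qed

locale sg_reduced_flow = sg_setting +
  assumes flow: "flow_eqs n S us uv hs hv"
    and a: "eq_a S us uv hp hs hv" and b: "eq_b n S us uv hp hs hv H"
    and nonzero: "\<And>p. p \<in> S \<Longrightarrow> complex_of_real (hp p) + hs p \<noteq> 0"
    and red: "reduced S (\<lambda>p. 1 / (complex_of_real (hp p) + hs p)) hv H"
    and unit_density: "\<And>p. p \<in> S \<Longrightarrow> density hp hs hv H p = 1"
begin

abbreviation "\<alpha> \<equiv> (\<lambda>p. 1 / (complex_of_real (hp p) + hs p))"

lemma alpha_norm:
  assumes "p \<in> S"
  shows "(cmod (\<alpha> p))\<^sup>2 = 1 / ((hp p)\<^sup>2 + (cmod (hs p))\<^sup>2)"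
    "(hp p)\<^sup>2 + (cmod (hs p))\<^sup>2 \<noteq> 0"
  using inverse_hs(2)[OF imaginary(2)[OF assms] nonzero[OF assms]]
    hs_conj_product(2)[OF imaginary(2)[OF assms], of "hp p"]
  by (simp_all add: norm_divide power_divide)

lemma sum_hv: "p \<in> S \<Longrightarrow> (\<Sum>i = 0..<m. cnj (hv p $ i) * hv p $ i) = complex_of_real (normsq (hv p))"
  using carrier(2) cdot_self by (simp add: cdot_eq_sum[symmetric])

text \<open>The entries of a rank-one H factor, so the double sum of squared moduli is |\<alpha>|^2
  times the square of \<open>normsq (hv p)\<close>. As \<open>hs\<close> is imaginary, -hs^2 equals
  |hs|^2 and joins hp^2 to form 1/|\<alpha>|^2.\<close>

lemma normalisation:
  assumes "p \<in> S"
  shows "1 / (cmod (\<alpha> p))\<^sup>2 + (cmod (\<alpha> p))\<^sup>2 * (normsq (hv p))\<^sup>2 + 2 * normsq (hv p) = 1"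
proof -
  define N where "N = complex_of_real (normsq (hv p))"
  have "(\<Sum>i = 0..<m. \<Sum>j = 0..<m. H p $$ (i, j) * cnj (H p $$ (i, j)))
      = (\<Sum>i = 0..<m. \<Sum>j = 0..<m. \<alpha> p * cnj (\<alpha> p)
          * ((cnj (hv p $ i) * hv p $ i) * (cnj (hv p $ j) * hv p $ j)))"
    by (intro sum.cong refl) (simp add: reduced_nth[OF red assms] mult_ac)
  also have "\<dots> = \<alpha> p * cnj (\<alpha> p) * (\<Sum>i = 0..<m. \<Sum>j = 0..<m.
      (cnj (hv p $ i) * hv p $ i) * (cnj (hv p $ j) * hv p $ j))"
    by (simp only: sum_distrib_left)
  also have "\<dots> = \<alpha> p * cnj (\<alpha> p) * N\<^sup>2"
    by (simp only: sum_product[symmetric] sum_hv[OF assms] N_def power2_eq_square)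
  also have "\<alpha> p * cnj (\<alpha> p) = complex_of_real ((cmod (\<alpha> p))\<^sup>2)"
    by (metis complex_norm_square of_real_power)
  finally have "(complex_of_real (hp p))\<^sup>2 + complex_of_real ((cmod (\<alpha> p))\<^sup>2) * N\<^sup>2
      - (hs p)\<^sup>2 + 2 * N = 1"
    using unit_density[OF assms] unfolding density_eq_sum[OF assms] sum_hv[OF assms] N_def by simp
  moreover have "(hs p)\<^sup>2 = - complex_of_real ((cmod (hs p))\<^sup>2)"
    using imaginary(2)[OF assms] by (simp add: complex_eq_iff cmod_power2) (simp add: power2_eq_square)
  ultimately have "complex_of_real ((hp p)\<^sup>2 + (cmod (\<alpha> p))\<^sup>2 * (normsq (hv p))\<^sup>2
      + (cmod (hs p))\<^sup>2 + 2 * normsq (hv p)) = complex_of_real 1"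
    by (simp add: N_def)
  then have "(hp p)\<^sup>2 + (cmod (\<alpha> p))\<^sup>2 * (normsq (hv p))\<^sup>2 + (cmod (hs p))\<^sup>2 + 2 * normsq (hv p) = 1"
    unfolding of_real_eq_iff .
  then show ?thesis
    using alpha_norm[OF assms] by simp
qed

text \<open>Unlike the usual sign it is 1 at zero, because \<open>sign_fun\<close> admits only 1 and
  -1; where \<open>hp\<close> vanishes so does the root.\<close>

definition sgn_A :: "real \<times> real \<Rightarrow> real" where
  "sgn_A p = (if hp p \<ge> 0 then 1 else - 1)"

definition sgn_root :: "real \<times> real \<Rightarrow> real" where
  "sgn_root p = (if 1 / (cmod (\<alpha> p))\<^sup>2 \<ge> 1 / 2 - normsq (hv p) then 1 else - 1)"

lemma sign_fun_sgn: "sign_fun sgn_A" "sign_fun sgn_root"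
  by (simp_all add: sign_fun_def sgn_A_def sgn_root_def)

lemma solve_normalisation:
  assumes "p \<in> S"
  shows "1 - 4 * normsq (hv p) \<ge> 0"
    "1 / (cmod (\<alpha> p))\<^sup>2 = - (normsq (hv p) - 1 / 2) + sgn_root p * (1 / 2) * sqrt (1 - 4 * normsq (hv p))"
    "1 / (cmod (\<alpha> p))\<^sup>2 - (cmod (hs p))\<^sup>2 \<ge> 0"
    "hp p = sgn_A p * sqrt (1 / (cmod (\<alpha> p))\<^sup>2 - (cmod (hs p))\<^sup>2)"
proof -
  have 1: "1 / (cmod (\<alpha> p))\<^sup>2 - (cmod (hs p))\<^sup>2 = (hp p)\<^sup>2"
    using alpha_norm[OF assms] by simp
  then show "1 / (cmod (\<alpha> p))\<^sup>2 - (cmod (hs p))\<^sup>2 \<ge> 0"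
    by simp
  show "hp p = sgn_A p * sqrt (1 / (cmod (\<alpha> p))\<^sup>2 - (cmod (hs p))\<^sup>2)"
    unfolding 1 by (simp add: sgn_A_def)
  have "1 / (cmod (\<alpha> p))\<^sup>2 \<noteq> 0"
    using alpha_norm[OF assms] by simp
  \<comment> \<open>With X = 1/|\<alpha>|^2 the factor |\<alpha>|^2 becomes division by X, the form
    required by \<open>quadratic_roots\<close>.\<close>
  moreover have "1 / (cmod (\<alpha> p))\<^sup>2 + (normsq (hv p))\<^sup>2 / (1 / (cmod (\<alpha> p))\<^sup>2) + 2 * normsq (hv p) = 1"
    using normalisation[OF assms] by (simp add: mult.commute)
  note * = quadratic_roots[OF calculation this]
  show "1 - 4 * normsq (hv p) \<ge> 0"
    by (rule *(1))
  show "1 / (cmod (\<alpha> p))\<^sup>2 = - (normsq (hv p) - 1 / 2) + sgn_root p * (1 / 2) * sqrt (1 - 4 * normsq (hv p))"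
    unfolding sgn_root_def by (rule *(2))
qed

text \<open>Reading the old time as \<open>c\<close> times the new one multiplies time derivatives
  by \<open>c\<close>, which removes the factor 1/\<open>c\<close> from the flow equations.\<close>

abbreviation "c \<equiv> sqrt (chi n)"
abbreviation "S' \<equiv> rescale_dom c S"
abbreviation "us' \<equiv> rescale_t c us"
abbreviation "uv' \<equiv> rescale_t c uv"

lemma c_pos: "c > 0"
  by (simp add: chi_def)

lemma rescaled_mem: "p \<in> S' \<Longrightarrow> (c * fst p, snd p) \<in> S"
  by (simp add: rescale_dom_def)

lemma Dt_rescaled:
  assumes "p \<in> S'"
  shows "Dt us' p = 2 * hs (c * fst p, snd p)"
    "DtV uv' p = - conjugate (hv (c * fst p, snd p))"
proof -
  let ?p = "(c * fst p, snd p)"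
  note P = rescaled_mem[OF assms]
  have "Dt us ?p = complex_of_real (2 / c) * hs ?p"
    and flow_v: "DtV uv ?p = complex_of_real (- 1 / c) \<cdot>\<^sub>v conjugate (hv ?p)"
    using flow P by (auto simp: flow_eqs_def)
  then show "Dt us' p = 2 * hs ?p"
    using Dt_rescale[OF open_S smooth_fun_imp_differentiable_on[OF smooth(1)] assms] c_pos
    by (simp add: scaleR_conv_of_real)
  note dims = carrier(4,5)[OF P]
  show "DtV uv' p = - conjugate (hv ?p)"
  proof (rule eq_vecI)
    show "dim_vec (DtV uv' p) = dim_vec (- conjugate (hv ?p))"
      using dims by (simp add: DtV_def rescale_t_def)
    fix i assume "i < dim_vec (- conjugate (hv ?p))"
    then have i: "i < m" using dims by simp
    have "DtV uv' p $ i = Dt (rescale_t c (\<lambda>q. uv q $ i)) p"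
      using dims i by (simp add: DtV_def rescale_t_def)
    also have "\<dots> = c *\<^sub>R Dt (\<lambda>q. uv q $ i) ?p"
      by (rule Dt_rescale[OF open_S smooth_fun_imp_differentiable_on[OF smooth_vecD(3)[OF smooth(2) i]] assms])
    also have "Dt (\<lambda>q. uv q $ i) ?p = DtV uv ?p $ i"
      using dims i by (simp add: DtV_def)
    also have "c *\<^sub>R (DtV uv ?p $ i) = - cnj (hv ?p $ i)"
      unfolding flow_v using dims i c_pos by (simp add: scaleR_conv_of_real)
    finally show "DtV uv' p $ i = (- conjugate (hv ?p)) $ i"
      using dims i by simp
  qed
qed

text \<open>The time derivatives are known explicitly on all of the open set \<open>S'\<close>, so
  these formulas may be differentiated in x. As x is not rescaled, no factor \<open>c\<close>
  appears.\<close>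

lemma Dx_Dt_rescaled:
  assumes "p \<in> S'"
  shows "Dx (Dt us') p = 2 * Dx hs (c * fst p, snd p)"
    "i < m \<Longrightarrow> DxV (DtV uv') p $ i = - cnj (Dx (\<lambda>q. hv q $ i) (c * fst p, snd p))"
    "dim_vec (DxV (DtV uv') p) = m"
proof -
  note P = rescaled_mem[OF assms]
  note T = open_rescale_dom[OF open_S]
  show "Dx (Dt us') p = 2 * Dx hs (c * fst p, snd p)"
    by (rule Dx_eqI(2)[OF T assms Dt_rescaled(1)])
      (use has_vector_derivative_mult_right[OF has_Dx(2)[OF P], of 2] in simp_all)
  show dim: "dim_vec (DxV (DtV uv') p) = m"
    using carrier(5)[OF P] by (simp add: DxV_def Dt_rescaled[OF assms])
  show "DxV (DtV uv') p $ i = - cnj (Dx (\<lambda>q. hv q $ i) (c * fst p, snd p))" if i: "i < m"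
  proof -
    have "DtV uv' q $ i = - cnj (hv (c * fst q, snd q) $ i)" if "q \<in> S'" for q
      using carrier(5)[OF rescaled_mem[OF that]] i by (simp add: Dt_rescaled[OF that])
    then have "Dx (\<lambda>q. DtV uv' q $ i) p = - cnj (Dx (\<lambda>q. hv q $ i) (c * fst p, snd p))"
      by (rule Dx_eqI(2)[OF T assms])
        (use has_vector_derivative_minus[OF has_vector_derivative_cnj[OF has_Dx(3)[OF P i]]] in simp_all)
    then show ?thesis
      using dim i by (simp add: DxV_def)
  qed
qed

lemma normsq_uminus_conjugate: "normsq (- conjugate v) = normsq v"
  by (auto simp: normsq_def cdot_def scalar_prod_def intro!: sum.cong)

text \<open>Identifies h_parallel with A: the solved normalisation is rewritten through ut = 2 hs
  and the equality of the norms of \<open>DtV uv'\<close> and \<open>hv\<close>.\<close>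

lemma hp_rescaled:
  assumes "p \<in> S'"
  shows "rescale_t c hp p = sg_A (rescale_t c sgn_A p) (rescale_t c sgn_root p) (Dt us' p) (DtV uv' p)"
    "sg_radicand (rescale_t c sgn_root p) (Dt us' p) (DtV uv' p) \<ge> 0"
proof -
  note P = rescaled_mem[OF assms]
  note * = solve_normalisation[OF P]
  note A = sg_A_eq[OF imaginary(2)[OF P] _ *(3), of "DtV uv' p" "sgn_root (c * fst p, snd p)",
      unfolded Dt_rescaled(2)[OF assms] normsq_uminus_conjugate, OF *(2)]
  show "rescale_t c hp p = sg_A (rescale_t c sgn_A p) (rescale_t c sgn_root p) (Dt us' p) (DtV uv' p)"
    unfolding Dt_rescaled[OF assms] unfolding rescale_t_def A(2) by (rule *(4))
  show "sg_radicand (rescale_t c sgn_root p) (Dt us' p) (DtV uv' p) \<ge> 0"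
    unfolding Dt_rescaled[OF assms] unfolding rescale_t_def A(1) using *(3) by simp
qed

lemma sg_system_rescaled:
  "sg_system S' (rescale_t c sgn_A) (rescale_t c sgn_root) us' uv'"
  unfolding sg_system_def Let_def
proof (intro ballI conjI)
  fix p assume p: "p \<in> S'"
  define P where "P = (c * fst p, snd p)"
  have P: "P \<in> S" using rescaled_mem[OF p] by (simp add: P_def)
  note Dt = Dt_rescaled[OF p, folded P_def]
  note dims = carrier(1,2,4,5)[OF P]
  let ?A = "sg_A (rescale_t c sgn_A p) (rescale_t c sgn_root p) (Dt us' p) (DtV uv' p)"
  have A: "?A = hp P"
    using hp_rescaled(1)[OF p] by (simp add: rescale_t_def P_def)
  have u: "us' p = us P" "uv' p = uv P"
    by (simp_all add: rescale_t_def P_def)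
  have norm: "?A\<^sup>2 + 1 / 4 * (cmod (Dt us' p))\<^sup>2 = (hp P)\<^sup>2 + (cmod (hs P))\<^sup>2"
    unfolding A unfolding Dt by (simp add: norm_mult power_mult_distrib)
  define q where "q = hv P \<bullet> uv P"
  \<comment> \<open>\<open>cdot\<close> conjugates its first argument and \<open>DtV uv'\<close> is
    itself minus a conjugate, so the first inner product is minus the bilinear product
    \<open>q\<close>.\<close>
  have dot: "cdot (DtV uv' p) (uv' p) = - q" "cdot (uv' p) (DtV uv' p) = - cnj q"
    using dims unfolding Dt u q_def dot_eq_sum[OF P]
    by (simp_all add: cdot_eq_sum[of _ m] sum_negf[symmetric] mult_ac)
  show "0 \<le> 1 - 4 * normsq (DtV uv' p)"
    using solve_normalisation(1)[OF P] by (simp add: Dt normsq_uminus_conjugate)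
  show "0 \<le> sg_radicand (rescale_t c sgn_root p) (Dt us' p) (DtV uv' p)"
    by (rule hp_rescaled(2)[OF p])
  show "?A\<^sup>2 + 1 / 4 * (cmod (Dt us' p))\<^sup>2 \<noteq> 0"
    unfolding norm by (rule alpha_norm(2)[OF P])
  have cnj_q: "cnj q = q - 2 * \<i> * complex_of_real (Im q)"
    by (simp add: complex_eq_iff)
  show "Dx (Dt us') p = - 4 * us' p * complex_of_real ?A
      + 4 * \<i> * complex_of_real (Im (cdot (DtV uv' p) (uv' p)))"
    unfolding Dx_Dt_rescaled(1)[OF p, folded P_def] Dx_hs[OF a P, folded q_def] A dot
    unfolding u cnj_q by (simp add: algebra_simps)
  \<comment> \<open>The quotient in the vector equation is the conjugate of \<alpha>, since that
    equation comes from the conjugate of (b).\<close>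
  have cnj_alpha: "(complex_of_real (hp P) + hs P) / complex_of_real ((hp P)\<^sup>2 + (cmod (hs P))\<^sup>2)
      = cnj (\<alpha> P)"
    unfolding inverse_hs(1)[OF imaginary(2)[OF P] nonzero[OF P]]
    using cnj_imaginary(2)[OF P] by simp
  \<comment> \<open>The right-hand side is first expressed by the values at \<open>P\<close>, where
    it can be compared with (b) component by component.\<close>
  have "DxV (DtV uv') p =
      (- cnj q * ((complex_of_real (hp P) + hs P)
          / complex_of_real ((hp P)\<^sup>2 + (cmod (hs P))\<^sup>2))) \<cdot>\<^sub>v (- conjugate (hv P))
      - complex_of_real (hp P) \<cdot>\<^sub>v uv P + us P \<cdot>\<^sub>v (- conjugate (hv P)) + hs P \<cdot>\<^sub>v uv P"
    unfolding cnj_alpha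
  proof (rule eq_vecI)
    fix i
    assume "i < dim_vec ((- cnj q * cnj (\<alpha> P)) \<cdot>\<^sub>v (- conjugate (hv P))
      - complex_of_real (hp P) \<cdot>\<^sub>v uv P + us P \<cdot>\<^sub>v (- conjugate (hv P)) + hs P \<cdot>\<^sub>v uv P)"
    then have i: "i < m" using dims by simp
    have "DxV (DtV uv') p $ i = - cnj ((complex_of_real (hp P) + hs P) * cnj (uv P $ i)
        - (us P + \<alpha> P * q) * hv P $ i)"
      using Dx_Dt_rescaled(2)[OF p i, folded P_def] Dx_hv_reduced[OF red b P i] by (simp add: q_def)
    \<comment> \<open>Conjugation stops at \<alpha>: its conjugate is kept as an atom and never
      expanded into a quotient.\<close>
    also have "\<dots> = - (complex_of_real (hp P) - hs P) * uv P $ i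
        + (- us P + cnj (\<alpha> P) * cnj q) * cnj (hv P $ i)"
      using cnj_imaginary[OF P] by (simp only: complex_cnj_mult complex_cnj_add complex_cnj_diff
          complex_cnj_complex_of_real complex_cnj_cnj) (simp add: algebra_simps)
    also have "\<dots> = ((- cnj q * cnj (\<alpha> P)) \<cdot>\<^sub>v (- conjugate (hv P))
      - complex_of_real (hp P) \<cdot>\<^sub>v uv P + us P \<cdot>\<^sub>v (- conjugate (hv P)) + hs P \<cdot>\<^sub>v uv P) $ i"
      using dims i by (simp del: complex_cnj_divide) (simp add: algebra_simps)
    finally show "DxV (DtV uv') p $ i = ((- cnj q * cnj (\<alpha> P)) \<cdot>\<^sub>v (- conjugate (hv P))
      - complex_of_real (hp P) \<cdot>\<^sub>v uv P + us P \<cdot>\<^sub>v (- conjugate (hv P)) + hs P \<cdot>\<^sub>v uv P) $ i" .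
  qed (use dims Dx_Dt_rescaled(3)[OF p] in simp)
  then show "DxV (DtV uv') p =
      (cdot (uv' p) (DtV uv' p) * ((complex_of_real ?A + 1 / 2 * Dt us' p)
          / complex_of_real (?A\<^sup>2 + 1 / 4 * (cmod (Dt us' p))\<^sup>2))) \<cdot>\<^sub>v DtV uv' p
      - complex_of_real ?A \<cdot>\<^sub>v uv' p + us' p \<cdot>\<^sub>v DtV uv' p + (1 / 2 * Dt us' p) \<cdot>\<^sub>v uv' p"
    unfolding dot norm unfolding A u unfolding Dt by simp
qed

end


section \<open>Assembly of the four claims\<close>

theorem mainTheorem2:
  fixes n :: nat and S :: "(real \<times> real) set"
    and us hs :: "real \<times> real \<Rightarrow> complex"
    and uv hv :: "real \<times> real \<Rightarrow> complex vec"
    and hp :: "real \<times> real \<Rightarrow> real"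
    and H :: "real \<times> real \<Rightarrow> complex mat"
  assumes "n \<ge> 1" and "open S" and "sg_variables n S us uv hp hs hv H"
  shows
    \<comment> \<open>(i)\<close>
    "(\<forall>a :: real \<Rightarrow> complex \<Rightarrow> complex.
        let \<alpha> = (\<lambda>p. a (hp p) (hs p)) in
          (\<alpha> differentiable_on S \<and> reduced S \<alpha> hv H \<and>
            eq_a S us uv hp hs hv \<and> eq_b n S us uv hp hs hv H \<longrightarrow>
              (\<forall>p\<in>S. lhs_d uv hv H p =
                coeff1 \<alpha> us uv hv p \<cdot>\<^sub>m outer (hv p) (hv p)
                + coeff2 \<alpha> hp hs p \<cdot>\<^sub>m (outer (conjugate (uv p)) (hv p)
                    + outer (hv p) (conjugate (uv p))))) \<and>
          (\<forall>p\<in>S. coeff2 \<alpha> hp hs p = 0 \<longleftrightarrow>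
              complex_of_real (hp p) + hs p \<noteq> 0 \<and>
              \<alpha> p = 1 / (complex_of_real (hp p) + hs p)) \<and>
          ((\<forall>p\<in>S. coeff2 \<alpha> hp hs p = 0) \<and> eq_a S us uv hp hs hv \<and> eq_c S us uv hp hs hv \<longrightarrow>
              (\<forall>p\<in>S. coeff1 \<alpha> us uv hv p = 0)) \<and>
          ((\<forall>p\<in>S. coeff2 \<alpha> hp hs p = 0) \<and> reduced S \<alpha> hv H \<longrightarrow>
              (\<forall>p\<in>S. 
                \<alpha> p = 1 / (complex_of_real (hp p) + hs p) \<and>
                \<alpha> p = (complex_of_real (hp p) - hs p)
                  / complex_of_real ((hp p)\<^sup>2 + (cmod (hs p))\<^sup>2) \<and>
                H p = (1 / (complex_of_real (hp p) + hs p)) \<cdot>\<^sub>m outer (hv p) (hv p) \<and>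
                H p = ((complex_of_real (hp p) - hs p)
                  / complex_of_real ((hp p)\<^sup>2 + (cmod (hs p))\<^sup>2)) \<cdot>\<^sub>m outer (hv p) (hv p)) \<and>
              (eq_a S us uv hp hs hv \<and> eq_b n S us uv hp hs hv H \<and> eq_c S us uv hp hs hv \<longrightarrow>
                eq_d n S uv hv H)))
    \<comment> \<open>(ii)\<close>
    \<and> (eq_a S us uv hp hs hv \<and> eq_b n S us uv hp hs hv H \<and>
        eq_c S us uv hp hs hv \<and> eq_d n S uv hv H \<longrightarrow>
          (\<forall>p\<in>S. Dx (density hp hs hv H) p = 0))
    \<comment> \<open>(iii)\<close>
    \<and> (let \<alpha> = (\<lambda>p. 1 / (complex_of_real (hp p) + hs p)); c = sqrt (chi n) in
        flow_eqs n S us uv hs hv \<and>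
        eq_a S us uv hp hs hv \<and> eq_b n S us uv hp hs hv H \<and>
        eq_c S us uv hp hs hv \<and> eq_d n S uv hv H \<and>
        (\<forall>p\<in>S. complex_of_real (hp p) + hs p \<noteq> 0) \<and> reduced S \<alpha> hv H \<and>
        (\<forall>p\<in>S. density hp hs hv H p = 1) \<longrightarrow>
          (\<forall>p\<in>S. 1 / (cmod (\<alpha> p))\<^sup>2 + (cmod (\<alpha> p))\<^sup>2 * (normsq (hv p))\<^sup>2
              + 2 * normsq (hv p) = 1) \<and>
          (\<exists>\<sigma> \<epsilon>. sign_fun \<sigma> \<and> sign_fun \<epsilon> \<and>
            (\<forall>p\<in>S.
              1 - 4 * normsq (hv p) \<ge> 0 \<and>
              1 / (cmod (\<alpha> p))\<^sup>2 = - (normsq (hv p) - 1 / 2)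
                + \<epsilon> p * (1 / 2) * sqrt (1 - 4 * normsq (hv p)) \<and>
              1 / (cmod (\<alpha> p))\<^sup>2 - (cmod (hs p))\<^sup>2 \<ge> 0 \<and>
              hp p = \<sigma> p * sqrt (1 / (cmod (\<alpha> p))\<^sup>2 - (cmod (hs p))\<^sup>2)) \<and>
            (\<forall>p\<in>rescale_dom c S. rescale_t c hp p =
              sg_A (rescale_t c \<sigma> p) (rescale_t c \<epsilon> p)
                (Dt (rescale_t c us) p) (DtV (rescale_t c uv) p)) \<and>
            sg_system (rescale_dom c S) (rescale_t c \<sigma>) (rescale_t c \<epsilon>)
              (rescale_t c us) (rescale_t c uv)))
    \<comment> \<open>(iv)\<close>
    \<and> ((\<forall>v\<in>carrier_vec (n - 1). unitary_action (1\<^sub>m (n - 1)) v = v) \<and>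
       (\<forall>R\<in>unitary_group (n - 1). \<forall>R'\<in>unitary_group (n - 1). \<forall>v\<in>carrier_vec (n - 1).
          unitary_action (R * R') v = unitary_action R (unitary_action R' v)) \<and>
       (\<forall>R\<in>unitary_group (n - 1). \<forall>T \<sigma> \<epsilon> w wv.
          open T \<and> sign_fun \<sigma> \<and> sign_fun \<epsilon> \<and> sg_unknowns n T w wv \<longrightarrow>
            sg_unknowns n T w (\<lambda>p. unitary_action R (wv p)) \<and>
            (sg_system T \<sigma> \<epsilon> w (\<lambda>p. unitary_action R (wv p)) \<longleftrightarrow> sg_system T \<sigma> \<epsilon> w wv)))"
proof -
  interpret sg_setting n S us uv hp hs hv H
    using assms(2,3) by unfold_locales
  show ?thesis
  \<comment> \<open>Cases 1 to 3 are (i) to (iii). Cases 4 to 6 form (iv): identity, composition,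
    and invariance of the system.\<close>
  proof (intro conjI, goal_cases)
    case 1
    show ?case
      unfolding Let_def
    proof (intro allI conjI impI ballI, goal_cases)
      case (1 a p)
      \<comment> \<open>Differentiability of the composed coefficient makes its \<open>Dx\<close> a
        genuine derivative.\<close>
      then show ?case by (intro lhs_d_reduced Dx_works[OF open_S]) simp_all
    next
      case (2 a p)
      show ?case by (rule coeff2_eq_0_iff)
    next
      case (3 a p)
      then show ?case by (intro Dx_alpha(2)) simp_all
    next
      case (4 a p)
      then show ?case by (intro alpha_H_eq(1)) simp_all
    next
      case (5 a p)
      then show ?case by (intro alpha_H_eq(2)) simp_all
    next
      case (6 a p)
      \<comment> \<open>The formula for H does not mention \<alpha>, so unification cannot find
        it.\<close>
      then show ?case by (intro alpha_H_eq(3)[of "\<lambda>p. a (hp p) (hs p)"]) simp_all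
    next
      case (7 a p)
      then show ?case by (intro alpha_H_eq(4)[of "\<lambda>p. a (hp p) (hs p)"]) simp_all
    next
      case (8 a)
      then show ?case by (intro eq_d_reduced[of "\<lambda>p. a (hp p) (hs p)"]) simp_all
    qed
  next
    case 2
    show ?case using Dx_density by blast
  next
    case 3
    show ?case
      unfolding Let_def
    proof (intro impI)
      assume *: "flow_eqs n S us uv hs hv \<and>
        eq_a S us uv hp hs hv \<and> eq_b n S us uv hp hs hv H \<and>
        eq_c S us uv hp hs hv \<and> eq_d n S uv hv H \<and>
        (\<forall>p\<in>S. complex_of_real (hp p) + hs p \<noteq> 0) \<and>
        reduced S (\<lambda>p. 1 / (complex_of_real (hp p) + hs p)) hv H \<and>
        (\<forall>p\<in>S. density hp hs hv H p = 1)"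
      then interpret sg_reduced_flow n S us uv hp hs hv H
        by unfold_locales auto
      show "(\<forall>p\<in>S. 1 / (cmod (\<alpha> p))\<^sup>2 + (cmod (\<alpha> p))\<^sup>2 * (normsq (hv p))\<^sup>2
              + 2 * normsq (hv p) = 1) \<and>
          (\<exists>\<sigma> \<epsilon>. sign_fun \<sigma> \<and> sign_fun \<epsilon> \<and>
            (\<forall>p\<in>S.
              1 - 4 * normsq (hv p) \<ge> 0 \<and>
              1 / (cmod (\<alpha> p))\<^sup>2 = - (normsq (hv p) - 1 / 2)
                + \<epsilon> p * (1 / 2) * sqrt (1 - 4 * normsq (hv p)) \<and>
              1 / (cmod (\<alpha> p))\<^sup>2 - (cmod (hs p))\<^sup>2 \<ge> 0 \<and>
              hp p = \<sigma> p * sqrt (1 / (cmod (\<alpha> p))\<^sup>2 - (cmod (hs p))\<^sup>2)) \<and>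
            (\<forall>p\<in>rescale_dom c S. rescale_t c hp p =
              sg_A (rescale_t c \<sigma> p) (rescale_t c \<epsilon> p)
                (Dt (rescale_t c us) p) (DtV (rescale_t c uv) p)) \<and>
            sg_system (rescale_dom c S) (rescale_t c \<sigma>) (rescale_t c \<epsilon>)
              (rescale_t c us) (rescale_t c uv))"
      proof (rule conjI, goal_cases)
        case 1
        show ?case by (rule ballI) (rule normalisation)
      next
        case 2
        show ?case
          \<comment> \<open>The same pair of signs must serve the solved normalisation, the formula
            for A and the system.\<close>
          by (rule exI[of _ sgn_A], rule exI[of _ sgn_root], intro conjI ballI)
            (fact sign_fun_sgn sg_system_rescaled
              | erule solve_normalisation hp_rescaled(1))+
      qed
    qed
  next
    case 4
    show ?case using unitary_action_one by blast
  next
    case 5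
    show ?case using unitary_action_mult by blast
  next
    case 6
    show ?case
    proof (intro ballI allI impI)
      fix R T and \<sigma> \<epsilon> :: "real \<times> real \<Rightarrow> real" and w wv
      assume R: "R \<in> unitary_group (n - 1)"
        and *: "open T \<and> sign_fun \<sigma> \<and> sign_fun \<epsilon> \<and> sg_unknowns n T w wv"
      then have T: "open T" and wv: "smooth_vec (n - 1) T wv"
        by (auto simp: sg_unknowns_def)
      note U = unitary_action_mat[OF R]
      show "sg_unknowns n T w (\<lambda>p. unitary_action R (wv p)) \<and>
          (sg_system T \<sigma> \<epsilon> w (\<lambda>p. unitary_action R (wv p)) \<longleftrightarrow> sg_system T \<sigma> \<epsilon> w wv)"
        unfolding unitary_action_eq[OF R]
        using * smooth_vec_mult_mat[OF T wv U(1)] sg_system_mult_mat[OF T wv U]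
        by (simp add: sg_unknowns_def)
    qed
  qed
qed

end
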